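(* Let $(M,g)$ be an $n$-dimensional ($n>3$) weakly $Z$ symmetric manifold $(WZS)_n$ which is pseudosymmetric in the sense of R. Deszcz. If the $Z$ tensor is non singular, then $\omega_k=A_k-B_k$ is a closed 1-form.
   Context: $(M,g)$ is an $n$-dimensional Riemannian manifold with Levi-Civita connection $\nabla$; index notation with summation over repeated indices; $R_{jkl}{}^m$ is the Riemann tensor, $R_{jklm}=R_{jkl}{}^sg_{sm}$, $R_{kl}=-R_{mkl}{}^m$ the Ricci tensor, $R=g^{ij}R_{ij}$ the scalar curvature. Generalized $Z$ tensor: $Z_{kl}=R_{kl}+\phi\,g_{kl}$, where $\phi$ is an arbitrary scalar function. The manifold is weakly $Z$ symmetric, $(WZS)_n$, if for some $\phi$ there are covectors $A_k,B_k,D_k$ with $$\nabla_kZ_{jl}=A_kZ_{jl}+B_jZ_{kl}+D_lZ_{kj}.$$ The $Z$ tensor is non singular if there is a $(2,0)$ tensor $Z^{-1}$ with $(Z^{-1})^{kh}Z_{kl}=\delta^h{}_l$. A 1-form $\omega_k$ is closed if $\nabla_i\omega_j-\nabla_j\omega_i=0$. A Riemannian manifold is pseudosymmetric in the sense of R. Deszcz if $$(\nabla_s\nabla_i-\nabla_i\nabla_s)R_{jklm}=L_R\,(g_{js}R_{iklm}-g_{ji}R_{sklm}+g_{ks}R_{jilm}-g_{ki}R_{jslm}+g_{ls}R_{jkim}-g_{li}R_{jksm}+g_{ms}R_{jkli}-g_{mi}R_{jkls}),$$ where $L_R$ is a non null scalar function. *)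

theory Defs
  imports "HOL-Analysis.Analysis"
begin

section \<open>Smooth functions on open subsets of Euclidean space\<close>

definition partial :: "'n \<Rightarrow> (real^'n \<Rightarrow> real) \<Rightarrow> real^'n \<Rightarrow> real" where
  "partial i f x = frechet_derivative f (at x) (axis i 1)"

text \<open>For open \<open>S\<close> this is the usual class \<open>C\<^sup>k\<close>: a differentiable function all of whose partial
  derivatives are \<open>C\<^sup>k\<close> is \<open>C\<^bsup>k+1\<^esup>\<close>, and conversely.\<close>
primrec Ck_on :: "nat \<Rightarrow> (real^'n) set \<Rightarrow> (real^'n \<Rightarrow> real) \<Rightarrow> bool" where
  "Ck_on 0 S f \<longleftrightarrow> continuous_on S f"
| "Ck_on (Suc k) S f \<longleftrightarrow> f differentiable_on S \<and> (\<forall>i. Ck_on k S (partial i f))"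

definition smooth_on :: "(real^'n) set \<Rightarrow> (real^'n \<Rightarrow> real) \<Rightarrow> bool" where
  "smooth_on S f \<longleftrightarrow> (\<forall>k. Ck_on k S f)"


section \<open>Smooth manifolds\<close>

text \<open>A chart is a pair of its domain and its coordinate map; the values of the coordinate map
  outside the domain are irrelevant.\<close>
type_synonym ('a, 'n) chart = "'a set \<times> ('a \<Rightarrow> (real, 'n) vec)"

abbreviation cdom :: "('a, 'n::finite) chart \<Rightarrow> 'a set" where
  "cdom c \<equiv> fst c"

abbreviation coord :: "('a, 'n::finite) chart \<Rightarrow> 'a \<Rightarrow> real^'n" where
  "coord c \<equiv> snd c"

definition param :: "('a, 'n::finite) chart \<Rightarrow> real^'n \<Rightarrow> 'a" where
  "param c = inv_into (cdom c) (coord c)"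

definition is_chart :: "'a topology \<Rightarrow> ('a, 'n::finite) chart \<Rightarrow> bool" where
  "is_chart X c \<longleftrightarrow> openin X (cdom c) \<and> open (coord c ` cdom c) \<and>
     homeomorphic_map (subtopology X (cdom c)) (top_of_set (coord c ` cdom c)) (coord c)"

text \<open>The smooth structure is given by an arbitrary, not necessarily maximal, smooth atlas \<open>\<A>\<close>;
  the dimension is \<open>CARD('n)\<close>.\<close>
definition smooth_manifold :: "'a topology \<Rightarrow> ('a, 'n::finite) chart set \<Rightarrow> bool" where
  "smooth_manifold X \<A> \<longleftrightarrow>
     Hausdorff_space X \<and> second_countable X \<and>
     (\<forall>c\<in>\<A>. is_chart X c) \<and> (\<Union>c\<in>\<A>. cdom c) = topspace X \<and>
     (\<forall>c\<in>\<A>. \<forall>d\<in>\<A>. \<forall>a.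
        smooth_on (coord c ` (cdom c \<inter> cdom d)) (\<lambda>x. coord d (param c x) $ a))"

definition smooth_scalar :: "('a, 'n::finite) chart set \<Rightarrow> ('a \<Rightarrow> real) \<Rightarrow> bool" where
  "smooth_scalar \<A> f \<longleftrightarrow> (\<forall>c\<in>\<A>. smooth_on (coord c ` cdom c) (\<lambda>x. f (param c x)))"

text \<open>The coordinate derivative \<open>\<partial>f/\<partial>x\<^sup>k\<close> at \<open>p\<close>, where \<open>x\<close> are the coordinates of the chart \<open>c\<close>.\<close>
definition chart_partial :: "('a, 'n::finite) chart \<Rightarrow> 'n \<Rightarrow> ('a \<Rightarrow> real) \<Rightarrow> 'a \<Rightarrow> real" where
  "chart_partial c k f p = partial k (\<lambda>x. f (param c x)) (coord c p)"

text \<open>\<open>\<partial>y\<^sup>a/\<partial>x\<^sup>b\<close> at \<open>p\<close>, with \<open>x\<close> the coordinates of \<open>c\<close> and \<open>y\<close> those of \<open>d\<close>.\<close>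
definition jacobian :: "('a, 'n::finite) chart \<Rightarrow> ('a, 'n) chart \<Rightarrow> 'a \<Rightarrow> 'n \<Rightarrow> 'n \<Rightarrow> real" where
  "jacobian c d p a b = chart_partial c b (\<lambda>q. coord d q $ a) p"


section \<open>Tensor fields in index notation\<close>

text \<open>\<open>T c p up lo\<close> is the component of \<open>T\<close> in the chart \<open>c\<close> at the point \<open>p \<in> cdom c\<close> with list of
  upper indices \<open>up\<close> and list of lower indices \<open>lo\<close>.\<close>
type_synonym ('a, 'n) tensor = "('a, 'n) chart \<Rightarrow> 'a \<Rightarrow> 'n list \<Rightarrow> 'n list \<Rightarrow> real"

text \<open>Smooth tensor fields with \<open>r\<close> upper and \<open>s\<close> lower indices: smooth components in every chart,
  and the usual transformation law
  \<open>T'\<^bsup>a\<dots>\<^esup>\<^bsub>b\<dots>\<^esub> = \<partial>y\<^sup>a/\<partial>x\<^sup>u \<dots> \<partial>x\<^sup>v/\<partial>y\<^sup>b \<dots> T\<^bsup>u\<dots>\<^esup>\<^bsub>v\<dots>\<^esub>\<close>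
  between charts. The values on index lists of other lengths are irrelevant.\<close>
definition tensor_field ::
  "('a, 'n::finite) chart set \<Rightarrow> nat \<Rightarrow> nat \<Rightarrow> ('a, 'n) tensor \<Rightarrow> bool" where
  "tensor_field \<A> r s T \<longleftrightarrow>
     (\<forall>c\<in>\<A>. \<forall>up lo. length up = r \<longrightarrow> length lo = s \<longrightarrow>
        smooth_on (coord c ` cdom c) (\<lambda>x. T c (param c x) up lo)) \<and>
     (\<forall>c\<in>\<A>. \<forall>d\<in>\<A>. \<forall>p\<in>cdom c \<inter> cdom d. \<forall>up lo. length up = r \<longrightarrow> length lo = s \<longrightarrow>
        T d p up lo =
          (\<Sum>up'\<in>{xs. length xs = r}. \<Sum>lo'\<in>{xs. length xs = s}.
             (\<Prod>i<r. jacobian c d p (up ! i) (up' ! i)) *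
             (\<Prod>j<s. jacobian d c p (lo' ! j) (lo ! j)) * T c p up' lo'))"


section \<open>Riemannian metrics, Levi-Civita connection and curvature\<close>

definition riemannian_metric :: "('a, 'n::finite) chart set \<Rightarrow> ('a, 'n) tensor \<Rightarrow> bool" where
  "riemannian_metric \<A> g \<longleftrightarrow> tensor_field \<A> 0 2 g \<and>
     (\<forall>c\<in>\<A>. \<forall>p\<in>cdom c.
        (\<forall>i j. g c p [] [i, j] = g c p [] [j, i]) \<and>
        (\<forall>v :: real^'n. v \<noteq> 0 \<longrightarrow> (\<Sum>i\<in>UNIV. \<Sum>j\<in>UNIV. g c p [] [i, j] * v $ i * v $ j) > 0))"

definition riemannian_manifold ::
  "'a topology \<Rightarrow> ('a, 'n::finite) chart set \<Rightarrow> ('a, 'n) tensor \<Rightarrow> bool" where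
  "riemannian_manifold X \<A> g \<longleftrightarrow> smooth_manifold X \<A> \<and> riemannian_metric \<A> g"

text \<open>The components \<open>g\<^bsup>ij\<^esup>\<close> of the inverse metric.\<close>
definition inv_metric :: "('a, 'n::finite) tensor \<Rightarrow> ('a, 'n) chart \<Rightarrow> 'a \<Rightarrow> 'n \<Rightarrow> 'n \<Rightarrow> real" where
  "inv_metric g c p i j = matrix_inv (\<chi> i j. g c p [] [i, j]) $ i $ j"

text \<open>\<open>christoffel g c p k i j\<close> is \<open>\<Gamma>\<^sup>k\<^bsub>ij\<^esub>\<close>, the coefficients of the Levi-Civita connection; the theorem
  \<open>christoffel_iff_levi_civita\<close> below shows that they are the unique coefficients that are torsion free
  and metric.\<close>
definition christoffel ::
  "('a, 'n::finite) tensor \<Rightarrow> ('a, 'n) chart \<Rightarrow> 'a \<Rightarrow> 'n \<Rightarrow> 'n \<Rightarrow> 'n \<Rightarrow> real" where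
  "christoffel g c p k i j = (\<Sum>m\<in>UNIV. inv_metric g c p k m / 2 *
     (chart_partial c i (\<lambda>q. g c q [] [m, j]) p + chart_partial c j (\<lambda>q. g c q [] [m, i]) p
      - chart_partial c m (\<lambda>q. g c q [] [i, j]) p))"

text \<open>The covariant derivative; the derivative index is the first lower index of the result, so that
  \<open>nabla g T c p up (k # lo)\<close> is \<open>\<nabla>\<^sub>k T\<^bsup>up\<^esup>\<^bsub>lo\<^esub>\<close> and
  \<open>nabla g (nabla g T) c p up (s # i # lo)\<close> is \<open>\<nabla>\<^sub>s \<nabla>\<^sub>i T\<^bsup>up\<^esup>\<^bsub>lo\<^esub>\<close>.\<close>
primrec nabla ::
  "('a, 'n::finite) tensor \<Rightarrow> ('a, 'n) tensor \<Rightarrow> ('a, 'n) chart \<Rightarrow> 'a \<Rightarrow> 'n list \<Rightarrow> 'n list \<Rightarrow> real"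
where
  "nabla g T c p up [] = 0"
| "nabla g T c p up (k # lo) =
     chart_partial c k (\<lambda>q. T c q up lo) p
     + (\<Sum>a<length up. \<Sum>s\<in>UNIV. christoffel g c p (up ! a) k s * T c p (up[a := s]) lo)
     - (\<Sum>b<length lo. \<Sum>s\<in>UNIV. christoffel g c p s k (lo ! b) * T c p up (lo[b := s]))"

text \<open>\<open>riemann_mixed g c p j k l m\<close> is \<open>R\<^bsub>jkl\<^esub>\<^sup>m\<close>, with the sign fixed by
  \<open>(\<nabla>\<^sub>j \<nabla>\<^sub>k - \<nabla>\<^sub>k \<nabla>\<^sub>j) \<omega>\<^sub>l = R\<^bsub>jkl\<^esub>\<^sup>m \<omega>\<^sub>m\<close>. Then the Ricci tensor
  \<open>R\<^bsub>kl\<^esub> = - R\<^bsub>mkl\<^esub>\<^sup>m\<close> of a round sphere is positive.\<close>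
definition riemann_mixed ::
  "('a, 'n::finite) tensor \<Rightarrow> ('a, 'n) chart \<Rightarrow> 'a \<Rightarrow> 'n \<Rightarrow> 'n \<Rightarrow> 'n \<Rightarrow> 'n \<Rightarrow> real" where
  "riemann_mixed g c p j k l m =
     chart_partial c k (\<lambda>q. christoffel g c q m j l) p
     - chart_partial c j (\<lambda>q. christoffel g c q m k l) p
     + (\<Sum>s\<in>UNIV. christoffel g c p m k s * christoffel g c p s j l
                 - christoffel g c p m j s * christoffel g c p s k l)"

fun riemann :: "('a, 'n::finite) tensor \<Rightarrow> ('a, 'n) chart \<Rightarrow> 'a \<Rightarrow> 'n list \<Rightarrow> 'n list \<Rightarrow> real" where
  "riemann g c p [] [j, k, l, m] = (\<Sum>s\<in>UNIV. riemann_mixed g c p j k l s * g c p [] [s, m])"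
| "riemann g c p _ _ = 0"

fun ricci :: "('a, 'n::finite) tensor \<Rightarrow> ('a, 'n) chart \<Rightarrow> 'a \<Rightarrow> 'n list \<Rightarrow> 'n list \<Rightarrow> real" where
  "ricci g c p [] [k, l] = - (\<Sum>m\<in>UNIV. riemann_mixed g c p m k l m)"
| "ricci g c p _ _ = 0"


section \<open>The generalized Z tensor\<close>

definition Z_tensor :: "('a, 'n::finite) tensor \<Rightarrow> ('a \<Rightarrow> real) \<Rightarrow> ('a, 'n) tensor" where
  "Z_tensor g \<phi> c p up lo = ricci g c p up lo + \<phi> p * g c p up lo"

text \<open>\<open>(M, g)\<close> is weakly Z symmetric, witnessed by the scalar function \<open>\<phi>\<close> and the covectors
  \<open>A\<close>, \<open>B\<close>, \<open>D\<close>.\<close>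
definition weakly_Z_symmetric ::
  "('a, 'n::finite) chart set \<Rightarrow> ('a, 'n) tensor \<Rightarrow> ('a \<Rightarrow> real) \<Rightarrow>
   ('a, 'n) tensor \<Rightarrow> ('a, 'n) tensor \<Rightarrow> ('a, 'n) tensor \<Rightarrow> bool" where
  "weakly_Z_symmetric \<A> g \<phi> A B D \<longleftrightarrow>
     smooth_scalar \<A> \<phi> \<and> tensor_field \<A> 0 1 A \<and> tensor_field \<A> 0 1 B \<and> tensor_field \<A> 0 1 D \<and>
     (\<forall>c\<in>\<A>. \<forall>p\<in>cdom c. \<forall>k j l.
        nabla g (Z_tensor g \<phi>) c p [] [k, j, l] =
          A c p [] [k] * Z_tensor g \<phi> c p [] [j, l]
          + B c p [] [j] * Z_tensor g \<phi> c p [] [k, l]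
          + D c p [] [l] * Z_tensor g \<phi> c p [] [k, j])"

definition nonsingular :: "('a, 'n::finite) chart set \<Rightarrow> ('a, 'n) tensor \<Rightarrow> bool" where
  "nonsingular \<A> Z \<longleftrightarrow>
     (\<exists>W. tensor_field \<A> 2 0 W \<and>
        (\<forall>c\<in>\<A>. \<forall>p\<in>cdom c. \<forall>h l.
           (\<Sum>k\<in>UNIV. W c p [k, h] [] * Z c p [] [k, l]) = (if h = l then 1 else 0)))"


section \<open>Pseudosymmetric manifolds in the sense of Deszcz\<close>

text \<open>The scalar function \<open>L\<close> is non null in the sense of not being identically zero; no regularity
  is imposed on it.\<close>
definition deszcz_pseudosymmetric ::
  "'a topology \<Rightarrow> ('a, 'n::finite) chart set \<Rightarrow> ('a, 'n) tensor \<Rightarrow> bool" where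
  "deszcz_pseudosymmetric X \<A> g \<longleftrightarrow>
     (\<exists>L :: 'a \<Rightarrow> real. (\<exists>p\<in>topspace X. L p \<noteq> 0) \<and>
        (\<forall>c\<in>\<A>. \<forall>p\<in>cdom c. \<forall>s i j k l m.
           nabla g (nabla g (riemann g)) c p [] [s, i, j, k, l, m]
           - nabla g (nabla g (riemann g)) c p [] [i, s, j, k, l, m] =
           L p *
             (g c p [] [j, s] * riemann g c p [] [i, k, l, m]
              - g c p [] [j, i] * riemann g c p [] [s, k, l, m]
              + g c p [] [k, s] * riemann g c p [] [j, i, l, m]
              - g c p [] [k, i] * riemann g c p [] [j, s, l, m]
              + g c p [] [l, s] * riemann g c p [] [j, k, i, m]
              - g c p [] [l, i] * riemann g c p [] [j, k, s, m]
              + g c p [] [m, s] * riemann g c p [] [j, k, l, i]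
              - g c p [] [m, i] * riemann g c p [] [j, k, l, s])))"


section \<open>Closed 1-forms\<close>

definition closed_one_form ::
  "('a, 'n::finite) chart set \<Rightarrow> ('a, 'n) tensor \<Rightarrow> ('a, 'n) tensor \<Rightarrow> bool" where
  "closed_one_form \<A> g \<omega> \<longleftrightarrow> tensor_field \<A> 0 1 \<omega> \<and>
     (\<forall>c\<in>\<A>. \<forall>p\<in>cdom c. \<forall>i j. nabla g \<omega> c p [] [i, j] - nabla g \<omega> c p [] [j, i] = 0)"


section \<open>The Christoffel symbols as torsion-free metric connection\<close>

lemma inv_metric_right:
  assumes "riemannian_metric \<A> g" "c \<in> \<A>" "p \<in> cdom c"
  shows "(\<Sum>k\<in>UNIV. g c p [] [i, k] * inv_metric g c p k j) = (if i = j then 1 else 0)"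
    and "(\<Sum>k\<in>UNIV. inv_metric g c p i k * g c p [] [k, j]) = (if i = j then 1 else 0)"
proof -
  define G where "G = (\<chi> i j. g c p [] [i, j])"
  have "v = 0" if "G *v v = 0" for v
  proof (rule ccontr)
    assume "v \<noteq> 0"
    then have "(\<Sum>i\<in>UNIV. \<Sum>j\<in>UNIV. g c p [] [i, j] * v $ i * v $ j) > 0"
      using assms unfolding riemannian_metric_def by blast
    moreover have "(\<Sum>i\<in>UNIV. \<Sum>j\<in>UNIV. g c p [] [i, j] * v $ i * v $ j)
        = (\<Sum>i\<in>UNIV. v $ i * (G *v v) $ i)"
      by (simp add: G_def matrix_vector_mult_def sum_distrib_left mult_ac)
    ultimately show False using that by simp
  qed
  then have "\<exists>B. B ** G = mat 1"
    using matrix_left_invertible_ker[of G] by blast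
  then have inv: "invertible G"
    using invertible_left_inverse by blast
  then have "G ** matrix_inv G = mat 1" "matrix_inv G ** G = mat 1"
    unfolding matrix_inv_def using someI_ex[of "\<lambda>A'. G ** A' = mat 1 \<and> A' ** G = mat 1"]
    by (auto simp: invertible_def)
  then have "(G ** matrix_inv G) $ i $ j = (if i = j then 1 else 0)"
    "(matrix_inv G ** G) $ i $ j = (if i = j then 1 else 0)"
    by (simp_all add: mat_def)
  then show "(\<Sum>k\<in>UNIV. g c p [] [i, k] * inv_metric g c p k j) = (if i = j then 1 else 0)"
    "(\<Sum>k\<in>UNIV. inv_metric g c p i k * g c p [] [k, j]) = (if i = j then 1 else 0)"
    by (simp_all add: matrix_matrix_mult_def inv_metric_def G_def)
qed

lemma chart_partial_cong:
  assumes "is_chart X c" "p \<in> cdom c" "\<And>q. q \<in> cdom c \<Longrightarrow> u q = v q"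
  shows "chart_partial c k u p = chart_partial c k v p"
proof -
  let ?S = "coord c ` cdom c"
  have S: "open ?S" "coord c p \<in> ?S" using assms by (auto simp: is_chart_def)
  have eq: "u (param c x) = v (param c x)" if "x \<in> ?S" for x
    using assms(3)[of "param c x"] inv_into_into[OF that] by (simp add: param_def)
  have "((\<lambda>x. u (param c x)) has_derivative f') (at (coord c p)) \<longleftrightarrow>
        ((\<lambda>x. v (param c x)) has_derivative f') (at (coord c p))" for f'
    using has_derivative_transform_within_open[OF _ S, of "\<lambda>x. u (param c x)" f' UNIV "\<lambda>x. v (param c x)"]
      has_derivative_transform_within_open[OF _ S, of "\<lambda>x. v (param c x)" f' UNIV "\<lambda>x. u (param c x)"]
      eq by metis
  then show ?thesis
    by (simp add: chart_partial_def partial_def frechet_derivative_def)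
qed

theorem christoffel_iff_levi_civita:
  fixes \<Gamma> :: "'n::finite \<Rightarrow> 'n \<Rightarrow> 'n \<Rightarrow> real"
  assumes "riemannian_manifold X \<A> g" and c: "c \<in> \<A>" and p: "p \<in> cdom c"
  shows "(\<forall>k i j. \<Gamma> k i j = \<Gamma> k j i) \<and>
         (\<forall>k i j. chart_partial c k (\<lambda>q. g c q [] [i, j]) p
            - (\<Sum>s\<in>UNIV. \<Gamma> s k i * g c p [] [s, j]) - (\<Sum>s\<in>UNIV. \<Gamma> s k j * g c p [] [i, s]) = 0)
         \<longleftrightarrow> (\<forall>k i j. \<Gamma> k i j = christoffel g c p k i j)"
    (is "?sym \<and> ?met \<longleftrightarrow> ?eq")
proof -
  have met: "riemannian_metric \<A> g" and ch: "is_chart X c"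
    using assms by (auto simp: riemannian_manifold_def smooth_manifold_def)
  define h where "h i j = g c p [] [i, j]" for i j
  define d where "d k i j = chart_partial c k (\<lambda>q. g c q [] [i, j]) p" for k i j
  define L where "L m i j = (\<Sum>s\<in>UNIV. h m s * \<Gamma> s i j)" for m i j
  define iv where "iv = inv_metric g c p"
  have gsym: "g c q [] [i, j] = g c q [] [j, i]" if "q \<in> cdom c" for q i j
    using met c that unfolding riemannian_metric_def by blast
  have hsym: "h i j = h j i" for i j
    using gsym p by (simp add: h_def)
  have dsym: "d k i j = d k j i" for k i j
    unfolding d_def by (rule chart_partial_cong[OF ch p]) (rule gsym)
  have hiv: "(\<Sum>k\<in>UNIV. h i k * iv k j) = (if i = j then 1 else 0)"
    and ivh: "(\<Sum>k\<in>UNIV. iv i k * h k j) = (if i = j then 1 else 0)" for i j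
    using inv_metric_right[OF met c p, of i j] by (simp_all add: h_def iv_def)
  have chr: "christoffel g c p k i j = (\<Sum>m\<in>UNIV. iv k m * ((d i m j + d j m i - d m i j) / 2))"
    for k i j by (simp add: christoffel_def iv_def d_def)
  have lower: "?eq \<longleftrightarrow> (\<forall>m i j. L m i j = (d i m j + d j m i - d m i j) / 2)"
  proof (intro iffI allI)
    fix m i j assume ?eq
    have "L m i j = (\<Sum>s\<in>UNIV. \<Sum>t\<in>UNIV. (h m s * iv s t) * ((d i t j + d j t i - d t i j) / 2))"
      using \<open>?eq\<close> by (simp add: L_def chr sum_distrib_left mult.assoc)
    also have "\<dots> = (\<Sum>t\<in>UNIV. (\<Sum>s\<in>UNIV. h m s * iv s t) * ((d i t j + d j t i - d t i j) / 2))"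
      by (subst sum.swap) (simp only: sum_distrib_right)
    also have "\<dots> = (\<Sum>t\<in>UNIV. if t = m then (d i t j + d j t i - d t i j) / 2 else 0)"
      by (intro sum.cong) (auto simp: hiv)
    also have "\<dots> = (d i m j + d j m i - d m i j) / 2" by simp
    finally show "L m i j = (d i m j + d j m i - d m i j) / 2" .
  next
    fix k i j assume *: "\<forall>m i j. L m i j = (d i m j + d j m i - d m i j) / 2"
    have "christoffel g c p k i j = (\<Sum>m\<in>UNIV. \<Sum>s\<in>UNIV. (iv k m * h m s) * \<Gamma> s i j)"
      by (simp only: chr *[rule_format, symmetric]) (simp add: L_def sum_distrib_left mult.assoc)
    also have "\<dots> = (\<Sum>s\<in>UNIV. (\<Sum>m\<in>UNIV. iv k m * h m s) * \<Gamma> s i j)"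
      by (subst sum.swap) (simp only: sum_distrib_right)
    also have "\<dots> = (\<Sum>s\<in>UNIV. if s = k then \<Gamma> s i j else 0)"
      by (intro sum.cong) (auto simp: ivh)
    also have "\<dots> = \<Gamma> k i j" by simp
    finally show "\<Gamma> k i j = christoffel g c p k i j" by simp
  qed
  have "(\<Sum>s\<in>UNIV. \<Gamma> s k i * g c p [] [s, j]) = L j k i"
    "(\<Sum>s\<in>UNIV. \<Gamma> s k j * g c p [] [i, s]) = L i k j" for k i j
    using hsym by (simp_all add: L_def h_def mult.commute)
  then have met_iff: "?met \<longleftrightarrow> (\<forall>k i j. d k i j - L j k i - L i k j = 0)"
    by (simp add: d_def)
  show ?thesis
  proof
    assume a: "?sym \<and> ?met"
    then have Lsym: "L m i j = L m j i" for m i j by (simp add: L_def)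
    have e: "d k i j = L j k i + L i k j" for k i j using a met_iff by (simp add: algebra_simps)
    show ?eq unfolding lower
    proof (intro allI)
      fix m i j
      show "L m i j = (d i m j + d j m i - d m i j) / 2"
        using e[of i m j] e[of j m i] e[of m i j] Lsym[of j i m] Lsym[of m i j] Lsym[of i j m] by simp
    qed
  next
    assume a: ?eq
    then have e: "L m i j = (d i m j + d j m i - d m i j) / 2" for m i j using lower by blast
    have ?sym
    proof (intro allI)
      fix k i j
      have "christoffel g c p k i j = christoffel g c p k j i"
        unfolding chr using dsym by (intro sum.cong) (auto simp: add.commute)
      then show "\<Gamma> k i j = \<Gamma> k j i" using a by simp
    qed
    moreover have ?met unfolding met_iff
    proof (intro allI)
      fix k i j
      show "d k i j - L j k i - L i k j = 0"
        using e[of j k i] e[of i k j] dsym[of k i j] dsym[of i j k] dsym[of j k i] by simp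
    qed
    ultimately show "?sym \<and> ?met" by blast
  qed
qed

end

theory Submission
  imports Defs
begin

text \<open>Since \<open>Z\<close> is symmetric and non singular, \<open>B = D\<close>. Hence the cyclic sum over \<open>i, k, j\<close> of
  \<open>(\<nabla>\<^sub>i\<nabla>\<^sub>k - \<nabla>\<^sub>k\<nabla>\<^sub>i) Z\<^bsub>jl\<^esub>\<close> is the cyclic sum of
  \<open>(\<nabla>\<^sub>i\<omega>\<^sub>k - \<nabla>\<^sub>k\<omega>\<^sub>i) Z\<^bsub>jl\<^esub>\<close>, all other terms cancelling. On the other hand, by the Ricci
  identity and the first Bianchi identity it is the cyclic sum of \<open>R\<^bsub>ikl\<^esub>\<^sup>m R\<^bsub>jm\<^esub>\<close>. Contracting the
  pseudosymmetry condition expresses \<open>(\<nabla>\<^sub>s\<nabla>\<^sub>i - \<nabla>\<^sub>i\<nabla>\<^sub>s) R\<^bsub>kl\<^esub>\<close> through \<open>g\<close> and the Ricci tensor in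
  such a way that its cyclic sum, and with it that of \<open>R\<^bsub>ikl\<^esub>\<^sup>m R\<^bsub>jm\<^esub>\<close>, vanishes. Contraction with
  \<open>Z\<^sup>-\<^sup>1\<close> then leaves \<open>(n - 2) (\<nabla>\<^sub>i\<omega>\<^sub>k - \<nabla>\<^sub>k\<omega>\<^sub>i) = 0\<close>.\<close>

section \<open>Calculus of smooth functions on open sets\<close>

lemma partial_eqI:
  assumes "(f has_derivative f') (at x)"
  shows "partial i f x = f' (axis i 1)"
  using frechet_derivative_at[OF assms] by (simp add: partial_def)

lemma has_derivative_cong_open:
  assumes "open S" "x \<in> S" "\<And>y. y \<in> S \<Longrightarrow> f y = h y"
  shows "(f has_derivative f') (at x) \<longleftrightarrow> (h has_derivative f') (at x)"
  using has_derivative_transform_within_open[OF _ assms(1,2), of f f' UNIV h]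
    has_derivative_transform_within_open[OF _ assms(1,2), of h f' UNIV f] assms(3) by metis

lemma partial_cong:
  assumes "open S" "x \<in> S" "\<And>y. y \<in> S \<Longrightarrow> f y = h y"
  shows "partial i f x = partial i h x"
  unfolding partial_def frechet_derivative_def using has_derivative_cong_open[OF assms] by simp

lemma differentiable_on_openD:
  assumes "open S" "f differentiable_on S" "x \<in> S"
  shows "(f has_derivative frechet_derivative f (at x)) (at x)"
  using assms by (simp add: differentiable_on_eq_differentiable_at frechet_derivative_works)

lemma Ck_on_cong:
  assumes "open S" "\<And>y. y \<in> S \<Longrightarrow> f y = h y"
  shows "Ck_on k S f \<longleftrightarrow> Ck_on k S h"
  using assms(2)
proof (induction k arbitrary: f h)
  case 0
  then show ?case by (simp cong: continuous_on_cong)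
next
  case (Suc k)
  have "f differentiable_on S \<longleftrightarrow> h differentiable_on S"
    using has_derivative_cong_open[OF assms(1) _ Suc.prems]
    by (simp add: differentiable_on_eq_differentiable_at[OF assms(1)] differentiable_def)
  moreover have "Ck_on k S (partial i f) \<longleftrightarrow> Ck_on k S (partial i h)" for i
    using Suc by (intro Suc.IH partial_cong[OF assms(1)])
  ultimately show ?case by simp
qed

lemma Ck_on_SucD: "Ck_on (Suc k) S f \<Longrightarrow> Ck_on k S f"
proof (induction k arbitrary: f)
  case 0
  then show ?case by (simp add: differentiable_imp_continuous_on)
qed simp

lemma partial_const [simp]: "partial i (\<lambda>x. a) x = 0"
  by (simp add: partial_def)

lemma partial_add:
  assumes "open S" "f differentiable_on S" "h differentiable_on S" "x \<in> S"
  shows "partial i (\<lambda>x. f x + h x) x = partial i f x + partial i h x"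
  by (subst partial_eqI[OF has_derivative_add[OF differentiable_on_openD differentiable_on_openD]])
    (use assms in \<open>auto simp: partial_def\<close>)

lemma partial_mult:
  assumes "open S" "f differentiable_on S" "h differentiable_on S" "x \<in> S"
  shows "partial i (\<lambda>x. f x * h x) x = f x * partial i h x + partial i f x * h x"
  by (subst partial_eqI[OF has_derivative_mult[OF differentiable_on_openD differentiable_on_openD]])
    (use assms in \<open>auto simp: partial_def\<close>)

text \<open>The derivative is written as a product with the constant function \<open>- 1\<close> so
  that \<open>Ck_on_mult\<close> and \<open>Ck_on_const\<close> apply to it without
  rearrangement.\<close>

lemma partial_inverse:
  assumes "open S" "f differentiable_on S" "x \<in> S" "f x \<noteq> 0"
  shows "partial i (\<lambda>x. inverse (f x)) x = - 1 * (partial i f x * (inverse (f x) * inverse (f x)))"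
  by (subst partial_eqI[OF Deriv.has_derivative_inverse[OF _ differentiable_on_openD]])
    (use assms in \<open>auto simp: partial_def\<close>)

lemma Ck_on_const: "Ck_on k S (\<lambda>x. a)"
  by (induction k arbitrary: a) (simp_all add: partial_def[abs_def])

lemma Ck_on_add:
  assumes S: "open S" and "Ck_on k S f" "Ck_on k S h"
  shows "Ck_on k S (\<lambda>x. f x + h x)"
  using assms(2,3)
proof (induction k arbitrary: f h)
  case 0
  then show ?case by (auto intro: continuous_on_add)
next
  case (Suc k)
  have "Ck_on k S (partial i (\<lambda>x. f x + h x))" for i
    using Suc by (subst Ck_on_cong[OF S partial_add[OF S]]) auto
  then show ?case using Suc.prems by auto
qed

lemma Ck_on_mult:
  assumes S: "open S" and "Ck_on k S f" "Ck_on k S h"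
  shows "Ck_on k S (\<lambda>x. f x * h x)"
  using assms(2,3)
proof (induction k arbitrary: f h)
  case 0
  then show ?case by (auto intro: continuous_on_mult)
next
  case (Suc k)
  \<comment> \<open>The product rule leaves undifferentiated factors next to partial derivatives, so
    \<open>f\<close> and \<open>h\<close> are first weakened to order \<open>k\<close>.\<close>
  have "Ck_on k S (partial i (\<lambda>x. f x * h x))" for i
    using Suc.prems Ck_on_SucD[OF Suc.prems(1)] Ck_on_SucD[OF Suc.prems(2)]
    by (subst Ck_on_cong[OF S partial_mult[OF S]]) (auto intro!: Ck_on_add[OF S] Suc.IH)
  then show ?case using Suc.prems by auto
qed

lemma Ck_on_inverse:
  assumes S: "open S" and nz: "\<And>x. x \<in> S \<Longrightarrow> f x \<noteq> 0" and "Ck_on k S f"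
  shows "Ck_on k S (\<lambda>x. inverse (f x))"
  using assms(3)
proof (induction k)
  case 0
  then show ?case using nz by (auto intro: continuous_on_inverse)
next
  case (Suc k)
  \<comment> \<open>The derivative of the reciprocal contains the reciprocal again, but only at
    order \<open>k\<close>, which the induction hypothesis supplies.\<close>
  have inv: "Ck_on k S (\<lambda>x. inverse (f x))"
    by (rule Suc.IH[OF Ck_on_SucD[OF Suc.prems]])
  have "Ck_on k S (\<lambda>x. - 1 * (partial i f x * (inverse (f x) * inverse (f x))))" for i
    using Suc.prems by (intro Ck_on_mult[OF S] Ck_on_const inv) simp
  then have "Ck_on k S (partial i (\<lambda>x. inverse (f x)))" for i
    using Suc.prems nz by (subst Ck_on_cong[OF S partial_inverse[OF S]]) auto
  moreover have "(\<lambda>x. inverse (f x)) differentiable_on S"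
    using Suc.prems nz by (auto simp: differentiable_on_def intro: differentiable_inverse)
  ultimately show ?case by simp
qed

section \<open>Symmetry of second partial derivatives\<close>

lemma has_real_derivative_line:
  assumes "open S" "f differentiable_on S" "y + s *\<^sub>R axis i 1 \<in> S"
  shows "((\<lambda>s. f (y + s *\<^sub>R axis i 1)) has_real_derivative partial i f (y + s *\<^sub>R axis i 1)) (at s)"
proof -
  let ?D = "frechet_derivative f (at (y + s *\<^sub>R axis i 1))"
  have D: "(f has_derivative ?D) (at (y + s *\<^sub>R axis i 1))"
    using assms by (rule differentiable_on_openD)
  have "((\<lambda>s. y + s *\<^sub>R axis i 1) has_derivative (\<lambda>s. s *\<^sub>R axis i 1)) (at s)"
    by (auto intro!: derivative_eq_intros)
  from diff_chain_at[OF this D]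
  have "((\<lambda>s. f (y + s *\<^sub>R axis i 1)) has_derivative (\<lambda>s. ?D (s *\<^sub>R axis i 1))) (at s)"
    by (simp add: o_def)
  moreover have "?D (r *\<^sub>R axis i 1) = partial i f (y + s *\<^sub>R axis i 1) * r" for r
    using linear_cmul[OF has_derivative_linear[OF D]] by (simp add: partial_def)
  ultimately show ?thesis
    by (simp add: has_field_derivative_def)
qed

text \<open>The second difference is a difference of differences. The mean value theorem in
  direction \<open>i\<close> turns it into an increment of \<open>partial i f\<close>, and a second
  use in direction \<open>j\<close> into a mixed derivative at an interior point of the
  square.\<close>

lemma second_difference_mvt:
  assumes S: "open S" and f: "f differentiable_on S" "partial i f differentiable_on S"
    and t: "t > 0" and sub: "\<And>a b. 0 \<le> a \<Longrightarrow> a \<le> t \<Longrightarrow> 0 \<le> b \<Longrightarrow> b \<le> t \<Longrightarrow>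
      x + a *\<^sub>R axis i 1 + b *\<^sub>R axis j 1 \<in> S"
  shows "\<exists>a b. 0 < a \<and> a < t \<and> 0 < b \<and> b < t \<and>
    f (x + t *\<^sub>R axis i 1 + t *\<^sub>R axis j 1) - f (x + t *\<^sub>R axis i 1) - f (x + t *\<^sub>R axis j 1) + f x
    = t * (t * partial j (partial i f) (x + a *\<^sub>R axis i 1 + b *\<^sub>R axis j 1))"
proof -
  let ?p = "\<lambda>a b. x + a *\<^sub>R axis i 1 + b *\<^sub>R axis j (1::real)"
  have swap: "x + b *\<^sub>R axis j 1 + a *\<^sub>R axis i 1 = ?p a b" for a b by simp
  have line: "((\<lambda>a. f (?p a b)) has_real_derivative partial i f (?p a b)) (at a)"
    if "0 \<le> a" "a \<le> t" "0 \<le> b" "b \<le> t" for a b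
    using has_real_derivative_line[OF S f(1), of "x + b *\<^sub>R axis j 1" a i] sub[OF that]
    unfolding swap .
  \<comment> \<open>The function of one variable here is \<open>a\<close> mapped to
    \<open>f (?p a t) - f (?p a 0)\<close>.\<close>
  have "\<exists>a>0. a < t \<and> (f (?p t t) - f (?p t 0)) - (f (?p 0 t) - f (?p 0 0))
      = (t - 0) * (partial i f (?p a t) - partial i f (?p a 0))"
    using t by (intro MVT2 DERIV_diff line) auto
  then obtain a where a: "0 < a" "a < t"
    "(f (?p t t) - f (?p t 0)) - (f (?p 0 t) - f (?p 0 0)) = t * (partial i f (?p a t) - partial i f (?p a 0))"
    by auto
  have "\<exists>b>0. b < t \<and> partial i f (?p a t) - partial i f (?p a 0)
      = (t - 0) * partial j (partial i f) (?p a b)"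
    using t a sub by (intro MVT2 has_real_derivative_line[OF S f(2)]) auto
  then obtain b where "0 < b" "b < t"
    "partial i f (?p a t) - partial i f (?p a 0) = t * partial j (partial i f) (?p a b)" by auto
  then show ?thesis using a by (intro exI[of _ a] exI[of _ b]) (simp add: algebra_simps)
qed

text \<open>The second difference is symmetric in the two directions, so
  \<open>second_difference_mvt\<close> makes the two mixed derivatives agree at two points
  arbitrarily close to \<open>x\<close>. Their continuity at \<open>x\<close> then forces equality
  there.\<close>

lemma partial_commute:
  assumes S: "open S" and f: "Ck_on 2 S f" and x: "x \<in> S"
  shows "partial i (partial j f) x = partial j (partial i f) x"
proof (rule ccontr)
  let ?P = "partial i (partial j f)" and ?Q = "partial j (partial i f)"
  let ?p = "\<lambda>a b. x + a *\<^sub>R axis i 1 + b *\<^sub>R axis j (1::real)"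
  have diff: "f differentiable_on S" "partial k f differentiable_on S"
    "continuous_on S (partial l (partial k f))" for k l
    using f by (auto simp: numeral_2_eq_2)
  assume "?P x \<noteq> ?Q x"
  \<comment> \<open>Half the supposed gap: two deviations below \<open>e\<close> cannot bridge
    it.\<close>
  define e where "e = \<bar>?P x - ?Q x\<bar> / 2"
  have e: "e > 0" using \<open>?P x \<noteq> ?Q x\<close> by (simp add: e_def)
  have "isCont ?P x" "isCont ?Q x"
    using diff(3) continuous_on_eq_continuous_at[OF S] x by auto
  then obtain d1 d2 where d: "d1 > 0" "d2 > 0"
    "\<And>y. dist y x < d1 \<Longrightarrow> \<bar>?P y - ?P x\<bar> < e" "\<And>y. dist y x < d2 \<Longrightarrow> \<bar>?Q y - ?Q x\<bar> < e"
    using e unfolding continuous_at_eps_delta dist_real_def by metis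
  obtain d3 where d3: "d3 > 0" "ball x d3 \<subseteq> S" using S x openE by blast
  \<comment> \<open>Points of the square of side \<open>t\<close> lie within \<open>2 * t\<close> of
    \<open>x\<close>; the divisor 3 keeps this strictly below all three radii.\<close>
  define t where "t = min d1 (min d2 d3) / 3"
  have t: "t > 0" "2 * t < d1" "2 * t < d2" "2 * t < d3" using d d3 by (auto simp: t_def)
  have near: "dist (?p a b) x \<le> 2 * t" if "0 \<le> a" "a \<le> t" "0 \<le> b" "b \<le> t" for a b
  proof -
    have "dist (?p a b) x = norm (a *\<^sub>R axis i 1 + b *\<^sub>R axis j (1::real))" 
      by (simp add: dist_norm add.assoc)
    also have "\<dots> \<le> \<bar>a\<bar> + \<bar>b\<bar>"
      using norm_triangle_ineq[of "a *\<^sub>R axis i (1::real)" "b *\<^sub>R axis j 1"] by (simp add: norm_axis_1)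
    finally show ?thesis using that by simp
  qed
  have sub: "?p a b \<in> S" if "0 \<le> a" "a \<le> t" "0 \<le> b" "b \<le> t" for a b
    using near[OF that] t d3 by (auto simp: dist_commute subset_iff)
  obtain a b where ab: "0 < a" "a < t" "0 < b" "b < t"
    "f (?p t t) - f (x + t *\<^sub>R axis i 1) - f (x + t *\<^sub>R axis j 1) + f x = t * (t * ?Q (?p a b))"
    using second_difference_mvt[OF S diff(1,2) t(1), of x i j] sub by metis
  have swap: "x + a *\<^sub>R axis j 1 + b *\<^sub>R axis i (1::real) = ?p b a" for a b by simp
  obtain a' b' where ab': "0 < a'" "a' < t" "0 < b'" "b' < t"
    "f (?p t t) - f (x + t *\<^sub>R axis j 1) - f (x + t *\<^sub>R axis i 1) + f x = t * (t * ?P (?p b' a'))"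
    using second_difference_mvt[OF S diff(1,2) t(1), of x j i] sub unfolding swap by metis
  have "t * (t * ?Q (?p a b)) = t * (t * ?P (?p b' a'))" using ab(5) ab'(5) by linarith
  then have "?Q (?p a b) = ?P (?p b' a')" using t(1) by simp
  moreover have "\<bar>?Q (?p a b) - ?Q x\<bar> < e" using ab near[of a b] t d(4) by auto
  moreover have "\<bar>?P (?p b' a') - ?P x\<bar> < e" using ab' near[of b' a'] t d(3) by auto
  ultimately have "\<bar>?P x - ?Q x\<bar> < 2 * e" by (smt (verit))
  then show False by (simp add: e_def)
qed

section \<open>Calculus in a single chart\<close>

definition smooth_in :: "('a, 'n::finite) chart \<Rightarrow> ('a \<Rightarrow> real) \<Rightarrow> bool" where
  "smooth_in c f \<longleftrightarrow> smooth_on (coord c ` cdom c) (\<lambda>x. f (param c x))"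

locale chart =
  fixes X :: "'a topology" and c :: "('a, 'n::finite) chart"
  assumes is_chart: "is_chart X c"
begin

lemma open_coord: "open (coord c ` cdom c)"
  using is_chart by (simp add: is_chart_def)

text \<open>A homeomorphism is injective on the topspace of its domain, which is
  \<open>cdom c\<close> because an open set lies inside the topspace of \<open>X\<close>.\<close>

lemma param_coord:
  assumes "p \<in> cdom c"
  shows "param c (coord c p) = p"
proof -
  have "openin X (cdom c)" and
    "homeomorphic_map (subtopology X (cdom c)) (top_of_set (coord c ` cdom c)) (coord c)"
    using is_chart by (auto simp: is_chart_def)
  then have "inj_on (coord c) (cdom c)"
    using openin_subset by (fastforce dest: homeomorphic_imp_injective_map simp: Int_absorb1)
  then show ?thesis using assms by (simp add: param_def)
qed

lemma param_in: "x \<in> coord c ` cdom c \<Longrightarrow> param c x \<in> cdom c"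
  by (metis imageE param_coord)

lemma coord_param: "x \<in> coord c ` cdom c \<Longrightarrow> coord c (param c x) = x"
  by (metis imageE param_coord)

lemma smooth_in_cong:
  assumes "\<And>q. q \<in> cdom c \<Longrightarrow> f q = h q"
  shows "smooth_in c f \<longleftrightarrow> smooth_in c h"
  unfolding smooth_in_def smooth_on_def
  using Ck_on_cong[OF open_coord, of "\<lambda>x. f (param c x)" "\<lambda>x. h (param c x)"] assms param_in by metis

lemma smooth_in_const [intro, simp]: "smooth_in c (\<lambda>q. a)"
  by (simp add: smooth_in_def smooth_on_def Ck_on_const)

lemma smooth_in_add [intro]: "smooth_in c f \<Longrightarrow> smooth_in c h \<Longrightarrow> smooth_in c (\<lambda>q. f q + h q)"
  by (simp add: smooth_in_def smooth_on_def Ck_on_add[OF open_coord])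

lemma smooth_in_mult [intro]: "smooth_in c f \<Longrightarrow> smooth_in c h \<Longrightarrow> smooth_in c (\<lambda>q. f q * h q)"
  by (simp add: smooth_in_def smooth_on_def Ck_on_mult[OF open_coord])

lemma smooth_in_inverse:
  "smooth_in c f \<Longrightarrow> (\<And>q. q \<in> cdom c \<Longrightarrow> f q \<noteq> 0) \<Longrightarrow> smooth_in c (\<lambda>q. inverse (f q))"
  by (simp add: smooth_in_def smooth_on_def Ck_on_inverse[OF open_coord] param_in)

lemma smooth_in_minus [intro]: "smooth_in c f \<Longrightarrow> smooth_in c (\<lambda>q. - f q)"
  using smooth_in_mult[of "\<lambda>q. - 1" f] by simp

lemma smooth_in_diff [intro]: "smooth_in c f \<Longrightarrow> smooth_in c h \<Longrightarrow> smooth_in c (\<lambda>q. f q - h q)"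
  using smooth_in_add[of f "\<lambda>q. - h q"] by auto

lemma smooth_in_sum [intro]:
  "(\<And>a. a \<in> I \<Longrightarrow> smooth_in c (f a)) \<Longrightarrow> smooth_in c (\<lambda>q. \<Sum>a\<in>I. f a q)"
  by (induction I rule: infinite_finite_induct) auto

lemma smooth_in_prod [intro]:
  "(\<And>a. a \<in> I \<Longrightarrow> smooth_in c (f a)) \<Longrightarrow> smooth_in c (\<lambda>q. \<Prod>a\<in>I. f a q)"
  by (induction I rule: infinite_finite_induct) auto

text \<open>The determinant is a polynomial in the entries.\<close>

lemma smooth_in_det:
  fixes F :: "'b::finite \<Rightarrow> 'b \<Rightarrow> 'a \<Rightarrow> real"
  assumes "\<And>a b. smooth_in c (F a b)"
  shows "smooth_in c (\<lambda>q. det (\<chi> a b. F a b q))"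
  unfolding det_def vec_lambda_beta by (intro smooth_in_sum smooth_in_mult smooth_in_prod smooth_in_const assms)

lemma smooth_in_partial [intro]:
  assumes "smooth_in c f"
  shows "smooth_in c (chart_partial c k f)"
proof -
  have "Ck_on n (coord c ` cdom c) (partial k (\<lambda>x. f (param c x)))" for n
    using assms Ck_on.simps(2) unfolding smooth_in_def smooth_on_def by metis
  then show ?thesis unfolding smooth_in_def smooth_on_def
    by (subst Ck_on_cong[OF open_coord, where h = "partial k (\<lambda>x. f (param c x))"])
      (simp_all add: chart_partial_def coord_param)
qed

lemma smooth_in_differentiable:
  "smooth_in c f \<Longrightarrow> (\<lambda>x. f (param c x)) differentiable_on coord c ` cdom c"
  using Ck_on.simps(2) unfolding smooth_in_def smooth_on_def by metis

lemma chart_partial_const [simp]: "chart_partial c k (\<lambda>q. a) p = 0"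
  by (simp add: chart_partial_def)

context
  fixes p
  assumes p: "p \<in> cdom c"
begin

lemma chart_partial_add:
  "smooth_in c f \<Longrightarrow> smooth_in c h \<Longrightarrow>
    chart_partial c k (\<lambda>q. f q + h q) p = chart_partial c k f p + chart_partial c k h p"
  using p by (simp add: chart_partial_def partial_add[OF open_coord] smooth_in_differentiable)

lemma chart_partial_mult:
  "smooth_in c f \<Longrightarrow> smooth_in c h \<Longrightarrow>
    chart_partial c k (\<lambda>q. f q * h q) p = f p * chart_partial c k h p + chart_partial c k f p * h p"
  using p by (simp add: chart_partial_def partial_mult[OF open_coord] smooth_in_differentiable param_coord)

lemma chart_partial_minus:
  "smooth_in c f \<Longrightarrow> chart_partial c k (\<lambda>q. - f q) p = - chart_partial c k f p"
  using chart_partial_mult[of "\<lambda>q. - 1" f] by simp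

lemma chart_partial_diff:
  "smooth_in c f \<Longrightarrow> smooth_in c h \<Longrightarrow>
    chart_partial c k (\<lambda>q. f q - h q) p = chart_partial c k f p - chart_partial c k h p"
  using chart_partial_add[of f "\<lambda>q. - h q"] chart_partial_minus[of h] by auto

lemma chart_partial_sum:
  assumes "finite I" "\<And>a. a \<in> I \<Longrightarrow> smooth_in c (f a)"
  shows "chart_partial c k (\<lambda>q. \<Sum>a\<in>I. f a q) p = (\<Sum>a\<in>I. chart_partial c k (f a) p)"
  using assms by (induction I rule: finite_induct) (simp_all add: chart_partial_add smooth_in_sum)

lemma chart_partial_commute:
  assumes "smooth_in c f"
  shows "chart_partial c i (chart_partial c j f) p = chart_partial c j (chart_partial c i f) p"
proof -
  let ?F = "\<lambda>x. f (param c x)"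
  have x: "coord c p \<in> coord c ` cdom c" using p by simp
  have "chart_partial c i (chart_partial c j f) p = partial i (partial j ?F) (coord c p)" for i j
    unfolding chart_partial_def
    by (rule partial_cong[OF open_coord x]) (simp add: coord_param)
  moreover have "Ck_on 2 (coord c ` cdom c) ?F" using assms by (simp add: smooth_in_def smooth_on_def)
  ultimately show ?thesis using partial_commute[OF open_coord _ x] by simp
qed

end

end


section \<open>The curvature tensor of a Riemannian metric\<close>

locale riemannian_chart =
  fixes X :: "'a topology" and \<A> :: "('a, 'n::finite) chart set" and g :: "('a, 'n) tensor"
    and c :: "('a, 'n) chart"
  assumes manifold: "riemannian_manifold X \<A> g" and atlas: "c \<in> \<A>"

sublocale riemannian_chart \<subseteq> chart
  using manifold atlas by unfold_locales (auto simp: riemannian_manifold_def smooth_manifold_def)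

context riemannian_chart
begin

lemma metric: "riemannian_metric \<A> g"
  using manifold by (simp add: riemannian_manifold_def)

lemma metric_sym: "p \<in> cdom c \<Longrightarrow> g c p [] [i, j] = g c p [] [j, i]"
  using metric atlas unfolding riemannian_metric_def by blast

lemmas inv_metric_mult = inv_metric_right[OF metric atlas]

lemma tensor_field_smooth_in:
  "tensor_field \<A> r s T \<Longrightarrow> length up = r \<Longrightarrow> length lo = s \<Longrightarrow> smooth_in c (\<lambda>q. T c q up lo)"
  using atlas by (simp add: tensor_field_def smooth_in_def)

lemma smooth_metric: "smooth_in c (\<lambda>q. g c q [] [i, j])"
  using metric by (intro tensor_field_smooth_in[of 0 2]) (auto simp: riemannian_metric_def)

text \<open>By Cramer's rule each entry of the inverse metric is a quotient of determinants of
  smooth matrices, with a denominator that vanishes nowhere on the chart.\<close>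

lemma smooth_inv_metric: "smooth_in c (\<lambda>q. inv_metric g c q i j)"
proof -
  let ?G = "\<lambda>q. \<chi> a b. g c q [] [a, b]"
  \<comment> \<open>The metric matrix with column \<open>i\<close> replaced by the
    \<open>j\<close>-th unit vector, as in Cramer's rule for column \<open>j\<close> of the
    inverse.\<close>
  let ?N = "\<lambda>q. \<chi> a b. if b = i then (if a = j then 1 else 0) else g c q [] [a, b]"
  have nz: "det (?G q) \<noteq> 0" if "q \<in> cdom c" for q
  proof -
    have "?G q ** (\<chi> i j. inv_metric g c q i j) = mat 1"
      by (simp add: matrix_matrix_mult_def mat_def vec_eq_iff inv_metric_mult(1)[OF that])
    then show ?thesis using invertible_right_inverse invertible_det_nz by blast
  qed
  have N: "smooth_in c (\<lambda>q. if b = i then (if a = j then 1 else 0) else g c q [] [a, b])" for a b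
    by (cases "b = i") (simp_all add: smooth_metric)
  have "inv_metric g c q i j = det (?N q) * inverse (det (?G q))" if "q \<in> cdom c" for q
  proof -
    have "?G q *v (\<chi> k. inv_metric g c q k j) = (\<chi> a. if a = j then 1 else 0)"
      by (simp add: matrix_vector_mult_def vec_eq_iff inv_metric_mult(1)[OF that])
    then show ?thesis
      unfolding cramer[OF nz[OF that]] by (simp add: vec_eq_iff divide_inverse cong: if_cong)
  qed
  then have "smooth_in c (\<lambda>q. inv_metric g c q i j) \<longleftrightarrow>
      smooth_in c (\<lambda>q. det (?N q) * inverse (det (?G q)))"
    by (rule smooth_in_cong)
  moreover have "smooth_in c (\<lambda>q. det (?N q))"
    by (rule smooth_in_det) (rule N)
  moreover have "smooth_in c (\<lambda>q. det (?G q))"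
    by (rule smooth_in_det) (rule smooth_metric)
  then have "smooth_in c (\<lambda>q. inverse (det (?G q)))"
    using nz by (rule smooth_in_inverse)
  ultimately show ?thesis by (simp only: smooth_in_mult)
qed

lemma smooth_christoffel: "smooth_in c (\<lambda>q. christoffel g c q k i j)"
proof -
  have "smooth_in c (\<lambda>q. \<Sum>m\<in>UNIV. inv_metric g c q k m * (1 / 2) *
     (chart_partial c i (\<lambda>q. g c q [] [m, j]) q + chart_partial c j (\<lambda>q. g c q [] [m, i]) q
      - chart_partial c m (\<lambda>q. g c q [] [i, j]) q))"
    by (intro smooth_in_sum smooth_in_mult smooth_in_add smooth_in_diff smooth_in_partial
        smooth_inv_metric smooth_metric smooth_in_const)
  then show ?thesis by (simp add: christoffel_def)
qed

lemma smooth_riemann_mixed: "smooth_in c (\<lambda>q. riemann_mixed g c q j k l m)"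
  unfolding riemann_mixed_def by (intro smooth_in_sum smooth_in_mult smooth_in_add smooth_in_diff
      smooth_in_partial smooth_christoffel)

lemma christoffel_sym: "p \<in> cdom c \<Longrightarrow> christoffel g c p k i j = christoffel g c p k j i"
  using christoffel_iff_levi_civita[OF manifold atlas, of p "christoffel g c p"] by blast

text \<open>Both second derivatives are expanded and everything symmetric in \<open>s\<close> and
  \<open>i\<close> is collected in \<open>Sym\<close> and \<open>K\<close>, which drop out of the
  commutator. What is left in each slot, derivatives of Christoffel symbols and products acting
  twice on that slot, is exactly \<open>riemann_mixed\<close>.\<close>

lemma ricci_identity:
  assumes T: "\<And>lo. length lo = r \<Longrightarrow> smooth_in c (\<lambda>q. T c q [] lo)"
    and lo: "length lo = r" and p: "p \<in> cdom c"
  shows "nabla g (nabla g T) c p [] (s # i # lo) - nabla g (nabla g T) c p [] (i # s # lo) =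
    (\<Sum>b<r. \<Sum>m\<in>UNIV. riemann_mixed g c p s i (lo ! b) m * T c p [] (lo[b := m]))"
proof -
  let ?G = "christoffel g c p" and ?D = "chart_partial c" and ?T = "T c p []"
  define dG where "dG s m i l = ?D s (\<lambda>q. christoffel g c q m i l) p" for s m i l
  define dT where "dT i lo = ?D i (\<lambda>q. T c q [] lo) p" for i lo
  \<comment> \<open>Symmetric because partial derivatives commute, the connection is torsion free,
    and the last two sums are exchanged.\<close>
  define Sym where "Sym s i = ?D s (?D i (\<lambda>q. T c q [] lo)) p - (\<Sum>m\<in>UNIV. ?G m s i * nabla g T c p [] (m # lo))
    - (\<Sum>b<r. \<Sum>m\<in>UNIV. ?G m i (lo ! b) * dT s (lo[b := m]))
    - (\<Sum>b<r. \<Sum>m\<in>UNIV. ?G m s (lo ! b) * dT i (lo[b := m]))" for s i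
  \<comment> \<open>The two Christoffel symbols act on different slots here, so the index
    replacements commute and exchanging the slots exchanges \<open>s\<close> and
    \<open>i\<close>.\<close>
  define K where "K s i = (\<Sum>b<r. \<Sum>m\<in>UNIV. \<Sum>b'<r. \<Sum>m'\<in>UNIV. if b' = b then 0 else
    ?G m s (lo ! b) * ?G m' i (lo ! b') * ?T (lo[b := m, b' := m']))" for s i
  have Sym: "Sym s i = Sym i s" for s i
    unfolding Sym_def using chart_partial_commute[OF p T[OF lo], of s i] christoffel_sym[OF p, of _ s i]
    by simp
  have K: "K s i = K i s" for s i
  proof -
    have "K s i = (\<Sum>b<r. \<Sum>b'<r. \<Sum>m\<in>UNIV. \<Sum>m'\<in>UNIV. if b' = b then 0 else
      ?G m s (lo ! b) * ?G m' i (lo ! b') * ?T (lo[b := m, b' := m']))"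
      unfolding K_def by (rule sum.cong[OF refl], rule sum.swap)
    also have "\<dots> = (\<Sum>b'<r. \<Sum>b<r. \<Sum>m'\<in>UNIV. \<Sum>m\<in>UNIV. if b' = b then 0 else
      ?G m s (lo ! b) * ?G m' i (lo ! b') * ?T (lo[b := m, b' := m']))"
      by (subst sum.swap, rule sum.cong[OF refl], rule sum.cong[OF refl], rule sum.swap)
    also have "\<dots> = (\<Sum>b'<r. \<Sum>b<r. \<Sum>m'\<in>UNIV. \<Sum>m\<in>UNIV. if b = b' then 0 else
      ?G m' i (lo ! b') * ?G m s (lo ! b) * ?T (lo[b' := m', b := m]))"
      by (intro sum.cong refl) (auto simp: list_update_swap)
    also have "\<dots> = K i s"
      unfolding K_def by (rule sum.cong[OF refl], rule sum.swap)
    finally show ?thesis .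
  qed
  have fst: "?D s (\<lambda>q. nabla g T c q [] (i # lo)) p = ?D s (?D i (\<lambda>q. T c q [] lo)) p
      - (\<Sum>b<r. \<Sum>m\<in>UNIV. ?G m i (lo ! b) * dT s (lo[b := m]) + dG s m i (lo ! b) * ?T (lo[b := m]))" for s i
    using lo unfolding nabla.simps dT_def dG_def
    by (simp add: chart_partial_diff[OF p] chart_partial_sum[OF p] chart_partial_mult[OF p] T
        smooth_in_sum smooth_in_mult smooth_in_diff smooth_in_partial smooth_christoffel)
  have thd: "(\<Sum>b<r. \<Sum>m\<in>UNIV. ?G m s (lo ! b) * nabla g T c p [] (i # lo[b := m])) =
      (\<Sum>b<r. \<Sum>m\<in>UNIV. ?G m s (lo ! b) * dT i (lo[b := m]))
      - (\<Sum>b<r. \<Sum>m\<in>UNIV. \<Sum>m'\<in>UNIV. ?G m s (lo ! b) * ?G m' i m * ?T (lo[b := m'])) - K s i" for s i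
  proof -
    have "?G m s (lo ! b) * nabla g T c p [] (i # lo[b := m]) = ?G m s (lo ! b) * dT i (lo[b := m])
       - (\<Sum>m'\<in>UNIV. ?G m s (lo ! b) * ?G m' i m * ?T (lo[b := m']))
       - (\<Sum>b'<r. \<Sum>m'\<in>UNIV. if b' = b then 0 else
    ?G m s (lo ! b) * ?G m' i (lo ! b') * ?T (lo[b := m, b' := m']))" if "b < r" for b m
    proof -
      \<comment> \<open>Slot \<open>b\<close> is split off: there the second replacement acts on the
        new index \<open>m\<close> and overwrites it. In all other slots the entries of
        \<open>lo\<close> are unchanged.\<close>
      have "(\<Sum>b'<r. \<Sum>m'\<in>UNIV. ?G m' i (lo[b := m] ! b') * ?T (lo[b := m, b' := m']))
        = (\<Sum>m'\<in>UNIV. ?G m' i m * ?T (lo[b := m']))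
          + (\<Sum>b'\<in>{..<r} - {b}. \<Sum>m'\<in>UNIV. ?G m' i (lo[b := m] ! b') * ?T (lo[b := m, b' := m']))"
        using that lo by (subst sum.remove[of _ b]) auto
      also have "(\<Sum>b'\<in>{..<r} - {b}. \<Sum>m'\<in>UNIV. ?G m' i (lo[b := m] ! b') * ?T (lo[b := m, b' := m']))
        = (\<Sum>b'<r. \<Sum>m'\<in>UNIV. if b' = b then 0 else ?G m' i (lo ! b') * ?T (lo[b := m, b' := m']))"
        by (rule sum.mono_neutral_cong_left) auto
      finally show ?thesis using lo
        by (simp add: dT_def right_diff_distrib distrib_left sum_distrib_left mult.assoc if_distrib cong: if_cong)
    qed
    then show ?thesis by (simp add: sum_subtractf K_def)
  qed
  have "nabla g (nabla g T) c p [] (s # i # lo) = Sym s i + K s i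
      - (\<Sum>b<r. \<Sum>m\<in>UNIV. dG s m i (lo ! b) * ?T (lo[b := m]))
      + (\<Sum>b<r. \<Sum>m\<in>UNIV. \<Sum>m'\<in>UNIV. ?G m s (lo ! b) * ?G m' i m * ?T (lo[b := m']))" for s i
  proof -
    have "nabla g (nabla g T) c p [] (s # i # lo) = ?D s (\<lambda>q. nabla g T c q [] (i # lo)) p
      - (\<Sum>m\<in>UNIV. ?G m s i * nabla g T c p [] (m # lo))
      - (\<Sum>b<r. \<Sum>m\<in>UNIV. ?G m s (lo ! b) * nabla g T c p [] (i # lo[b := m]))"
      \<comment> \<open>The derivative index \<open>i\<close> is slot 0 of \<open>i # lo\<close>;
        shifting the sum isolates its correction term from those of the slots of
        \<open>lo\<close>.\<close>
      using lo by (subst nabla.simps(2)) (simp add: sum.lessThan_Suc_shift del: nabla.simps sum.lessThan_Suc)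
    also have "\<dots> = Sym s i + K s i
      - (\<Sum>b<r. \<Sum>m\<in>UNIV. dG s m i (lo ! b) * ?T (lo[b := m]))
      + (\<Sum>b<r. \<Sum>m\<in>UNIV. \<Sum>m'\<in>UNIV. ?G m s (lo ! b) * ?G m' i m * ?T (lo[b := m']))"
      unfolding fst thd Sym_def by (simp add: sum.distrib)
    finally show ?thesis .
  qed
  moreover have "(\<Sum>m\<in>UNIV. \<Sum>m'\<in>UNIV. ?G m s (lo ! b) * ?G m' i m * ?T (lo[b := m']))
     = (\<Sum>m\<in>UNIV. (\<Sum>t\<in>UNIV. ?G m i t * ?G t s (lo ! b)) * ?T (lo[b := m]))" for s i b
    by (subst sum.swap) (simp add: sum_distrib_left sum_distrib_right mult_ac)
  ultimately have expand: "nabla g (nabla g T) c p [] (s # i # lo) = Sym s i + K s i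
      - (\<Sum>b<r. \<Sum>m\<in>UNIV. dG s m i (lo ! b) * ?T (lo[b := m]))
      + (\<Sum>b<r. \<Sum>m\<in>UNIV. (\<Sum>t\<in>UNIV. ?G m i t * ?G t s (lo ! b)) * ?T (lo[b := m]))" for s i
    by (simp only:)
  show ?thesis
    unfolding expand Sym[of s i] K[of s i] riemann_mixed_def dG_def[symmetric]
    by (simp add: sum_subtractf sum.distrib left_diff_distrib distrib_right)
qed

section \<open>Symmetries and traces of the curvature\<close>

lemma smooth_riemann:
  assumes "length lo = 4"
  shows "smooth_in c (\<lambda>q. riemann g c q [] lo)"
proof -
  obtain j k l m where "lo = [j, k, l, m]"
    using assms by (auto simp: numeral_eq_Suc length_Suc_conv)
  then show ?thesis
    by (simp add: smooth_in_sum smooth_in_mult smooth_riemann_mixed smooth_metric)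
qed

lemma smooth_ricci:
  assumes "length lo = 2"
  shows "smooth_in c (\<lambda>q. ricci g c q [] lo)"
proof -
  obtain k l where "lo = [k, l]"
    using assms by (auto simp: numeral_eq_Suc length_Suc_conv)
  then show ?thesis
    by (simp add: smooth_in_sum smooth_in_minus smooth_riemann_mixed)
qed

text \<open>Vanishing is assumed on the whole chart, since the outer derivative differentiates the
  components of the inner one.\<close>

lemma nabla_nabla_eq_0:
  assumes "\<And>q lo. q \<in> cdom c \<Longrightarrow> length lo = Suc r \<Longrightarrow> nabla g T c q [] lo = 0"
    and p: "p \<in> cdom c" and lo: "length lo = r"
  shows "nabla g (nabla g T) c p [] (s # i # lo) = 0"
proof -
  have "chart_partial c s (\<lambda>q. nabla g T c q [] (i # lo)) p = chart_partial c s (\<lambda>q. 0) p"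
    using lo by (intro chart_partial_cong[OF is_chart p] assms(1)) auto
  then show ?thesis
    by (subst nabla.simps(2)) (simp add: assms(1)[OF p] lo del: nabla.simps list_update.simps sum.lessThan_Suc)
qed

lemma nabla_metric:
  assumes "p \<in> cdom c" "length lo = 3"
  shows "nabla g g c p [] lo = 0"
proof -
  obtain k i j where "lo = [k, i, j]"
    using assms(2) by (auto simp: numeral_eq_Suc length_Suc_conv)
  moreover have "chart_partial c k (\<lambda>q. g c q [] [i, j]) p
      - (\<Sum>s\<in>UNIV. christoffel g c p s k i * g c p [] [s, j])
      - (\<Sum>s\<in>UNIV. christoffel g c p s k j * g c p [] [i, s]) = 0"
    using christoffel_iff_levi_civita[OF manifold atlas assms(1), of "christoffel g c p"] by blast
  ultimately show ?thesis by simp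
qed

text \<open>With \<open>v\<close> the inverse of the symmetric matrix \<open>h\<close>, the product
  of \<open>v\<close>, \<open>h\<close> and the transpose of \<open>v\<close> is evaluated by
  cancelling \<open>h\<close> on either side.\<close>

lemma inv_metric_sym:
  assumes p: "p \<in> cdom c"
  shows "inv_metric g c p i j = inv_metric g c p j i"
proof -
  let ?h = "\<lambda>i j. g c p [] [i, j]" and ?v = "inv_metric g c p"
  have "?v j i = (\<Sum>k\<in>UNIV. (\<Sum>l\<in>UNIV. ?v i l * ?h l k) * ?v j k)"
    by (simp add: inv_metric_mult(2)[OF p] if_distrib[of "\<lambda>x. x * _"] cong: if_cong)
  also have "\<dots> = (\<Sum>l\<in>UNIV. \<Sum>k\<in>UNIV. ?v i l * ?h l k * ?v j k)"
    by (subst sum.swap) (simp add: sum_distrib_right)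
  also have "\<dots> = (\<Sum>l\<in>UNIV. ?v i l * (\<Sum>k\<in>UNIV. ?v j k * ?h k l))"
    by (simp add: sum_distrib_left metric_sym[OF p, of _ l for l] mult_ac)
  also have "\<dots> = ?v i j"
    by (simp add: inv_metric_mult(2)[OF p] if_distrib[of "\<lambda>x. _ * x"] cong: if_cong)
  finally show ?thesis by simp
qed

lemma riemann_mixed_skew: "riemann_mixed g c p j k l m = - riemann_mixed g c p k j l m"
  by (simp add: riemann_mixed_def sum_subtractf)

text \<open>Once the symmetry of the Christoffel symbols is used, also under the derivative, all
  terms of the cyclic sum cancel in pairs.\<close>

lemma bianchi:
  assumes p: "p \<in> cdom c"
  shows "riemann_mixed g c p j k l m + riemann_mixed g c p k l j m + riemann_mixed g c p l j k m = 0"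
proof -
  have "chart_partial c k (\<lambda>q. christoffel g c q m j l) p = chart_partial c k (\<lambda>q. christoffel g c q m l j) p"
    for k j l by (rule chart_partial_cong[OF is_chart p]) (rule christoffel_sym)
  note D = this[of k j l] this[of j k l] this[of l j k]
  note G = christoffel_sym[OF p, of _ j l] christoffel_sym[OF p, of _ k l] christoffel_sym[OF p, of _ j k]
  show ?thesis
    unfolding riemann_mixed_def D G by (simp add: sum_subtractf)
qed

text \<open>The Ricci identity is applied to the metric itself, whose covariant derivatives
  vanish.\<close>

lemma riemann_skew:
  assumes p: "p \<in> cdom c"
  shows "riemann g c p [] [j, k, l, m] = - riemann g c p [] [j, k, m, l]"
proof -
  have "nabla g (nabla g g) c p [] (j # k # [l, m]) - nabla g (nabla g g) c p [] (k # j # [l, m]) =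
    (\<Sum>b<2. \<Sum>t\<in>UNIV. riemann_mixed g c p j k ([l, m] ! b) t * g c p [] ([l, m][b := t]))"
    using metric by (intro ricci_identity p tensor_field_smooth_in[of 0 2])
      (auto simp: riemannian_metric_def)
  moreover have "nabla g (nabla g g) c p [] (j # k # [l, m]) = 0" for j k
    by (rule nabla_nabla_eq_0[of 2, OF nabla_metric p]) auto
  ultimately have "0 = (\<Sum>t\<in>UNIV. riemann_mixed g c p j k l t * g c p [] [t, m]) +
      (\<Sum>t\<in>UNIV. riemann_mixed g c p j k m t * g c p [] [l, t])"
    by (simp add: numeral_2_eq_2)
  then show ?thesis by (simp add: metric_sym[OF p, of l])
qed

lemma riemann_raise:
  assumes p: "p \<in> cdom c"
  shows "(\<Sum>t\<in>UNIV. riemann g c p [] [j, k, l, t] * inv_metric g c p t m) = riemann_mixed g c p j k l m"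
proof -
  have "(\<Sum>t\<in>UNIV. riemann g c p [] [j, k, l, t] * inv_metric g c p t m)
    = (\<Sum>s\<in>UNIV. riemann_mixed g c p j k l s * (\<Sum>t\<in>UNIV. g c p [] [s, t] * inv_metric g c p t m))"
    by (simp add: sum_distrib_left sum_distrib_right mult.assoc) (rule sum.swap)
  also have "\<dots> = riemann_mixed g c p j k l m"
    by (simp add: inv_metric_mult(1)[OF p] if_distrib[of "\<lambda>x. _ * x"] cong: if_cong)
  finally show ?thesis .
qed

text \<open>Both sides become contractions of the fully lowered tensor with two copies of the
  inverse metric, where \<open>riemann_skew\<close> gives the sign.\<close>

lemma raised_riemann_skew:
  assumes p: "p \<in> cdom c"
  shows "(\<Sum>j\<in>UNIV. inv_metric g c p j m * riemann_mixed g c p s i j t) =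
    - (\<Sum>j\<in>UNIV. inv_metric g c p j t * riemann_mixed g c p s i j m)"
proof -
  let ?v = "inv_metric g c p"
  have *: "(\<Sum>j\<in>UNIV. ?v j m * riemann_mixed g c p s i j t) =
    (\<Sum>j\<in>UNIV. \<Sum>n\<in>UNIV. ?v j m * ?v n t * riemann g c p [] [s, i, j, n])" for m t
    by (simp only: riemann_raise[OF p, symmetric] sum_distrib_left mult_ac)
  have "(\<Sum>j\<in>UNIV. \<Sum>n\<in>UNIV. ?v j m * ?v n t * riemann g c p [] [s, i, j, n])
    = (\<Sum>n\<in>UNIV. \<Sum>j\<in>UNIV. - (?v n t * ?v j m * riemann g c p [] [s, i, n, j]))"
    by (subst sum.swap, intro sum.cong refl, subst riemann_skew[OF p]) (simp del: riemann.simps)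
  then show ?thesis unfolding * by (simp only: sum_negf)
qed

text \<open>A symmetric matrix contracted with a skew one gives a number equal to its own
  negative.\<close>

lemma riemann_mixed_trace:
  assumes p: "p \<in> cdom c"
  shows "(\<Sum>m\<in>UNIV. riemann_mixed g c p k l m m) = 0"
proof -
  let ?v = "inv_metric g c p"
  let ?S = "\<Sum>m\<in>UNIV. \<Sum>t\<in>UNIV. riemann g c p [] [k, l, m, t] * ?v t m"
  have "?S = (\<Sum>t\<in>UNIV. \<Sum>m\<in>UNIV. - (riemann g c p [] [k, l, t, m] * ?v m t))"
    by (subst sum.swap, intro sum.cong refl, subst riemann_skew[OF p], subst inv_metric_sym[OF p])
      (simp del: riemann.simps)
  then have "?S = - ?S" by (simp only: sum_negf)
  then show ?thesis by (simp add: riemann_raise[OF p] del: riemann.simps)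
qed

text \<open>The trace of the Bianchi identity has a middle term that vanishes by
  \<open>riemann_mixed_trace\<close>; the outer two are Ricci components up to sign.\<close>

lemma ricci_sym:
  assumes p: "p \<in> cdom c"
  shows "ricci g c p [] [k, l] = ricci g c p [] [l, k]"
proof -
  have "(\<Sum>m\<in>UNIV. riemann_mixed g c p m k l m + riemann_mixed g c p k l m m + riemann_mixed g c p l m k m) = 0"
    by (simp only: bianchi[OF p] sum.neutral_const)
  then show ?thesis
    using riemann_mixed_trace[OF p, of k l] riemann_mixed_skew[of p l _ k]
    by (simp add: sum.distrib sum_subtractf)
qed

lemma ricci_trace:
  assumes p: "p \<in> cdom c"
  shows "(\<Sum>j\<in>UNIV. \<Sum>m\<in>UNIV. inv_metric g c p j m * riemann g c p [] [j, k, l, m]) = - ricci g c p [] [k, l]"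
proof -
  have "(\<Sum>m\<in>UNIV. inv_metric g c p j m * riemann g c p [] [j, k, l, m]) = riemann_mixed g c p j k l j" for j
    by (subst riemann_raise[OF p, symmetric])
      (simp only: inv_metric_sym[OF p, of j] mult.commute)
  then show ?thesis by (simp del: riemann.simps)
qed

section \<open>Pseudosymmetry contracted to the Ricci tensor\<close>

text \<open>Contract the hypothesis with \<open>g\<^bsup>jm\<^esup>\<close>: by \<open>raised_riemann_skew\<close> the two terms of the Ricci
  identity that act on the contracted indices cancel.\<close>
lemma deszcz_ricci:
  assumes p: "p \<in> cdom c" and deszcz: "\<And>j m.
    nabla g (nabla g (riemann g)) c p [] [s, i, j, k, l, m]
           - nabla g (nabla g (riemann g)) c p [] [i, s, j, k, l, m] =
           L *
             (g c p [] [j, s] * riemann g c p [] [i, k, l, m]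
              - g c p [] [j, i] * riemann g c p [] [s, k, l, m]
              + g c p [] [k, s] * riemann g c p [] [j, i, l, m]
              - g c p [] [k, i] * riemann g c p [] [j, s, l, m]
              + g c p [] [l, s] * riemann g c p [] [j, k, i, m]
              - g c p [] [l, i] * riemann g c p [] [j, k, s, m]
              + g c p [] [m, s] * riemann g c p [] [j, k, l, i]
              - g c p [] [m, i] * riemann g c p [] [j, k, l, s])"
  shows "(\<Sum>t\<in>UNIV. riemann_mixed g c p s i k t * ricci g c p [] [t, l])
      + (\<Sum>t\<in>UNIV. riemann_mixed g c p s i l t * ricci g c p [] [k, t]) =
    L * (g c p [] [k, s] * ricci g c p [] [i, l] - g c p [] [k, i] * ricci g c p [] [s, l]
      + g c p [] [l, s] * ricci g c p [] [k, i] - g c p [] [l, i] * ricci g c p [] [k, s])"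
proof -
  let ?v = "inv_metric g c p" and ?M = "riemann_mixed g c p"
  define R where "R j k l m = riemann g c p [] [j, k, l, m]" for j k l m
  define h where "h i j = g c p [] [i, j]" for i j
  define C where "C f = (\<Sum>j\<in>UNIV. \<Sum>m\<in>UNIV. ?v j m * f j m)" for f :: "'n \<Rightarrow> 'n \<Rightarrow> real"
  have C_add: "C (\<lambda>j m. f j m + f' j m) = C f + C f'" and C_diff: "C (\<lambda>j m. f j m - f' j m) = C f - C f'"
    and C_mult: "C (\<lambda>j m. a * f j m) = a * C f" for f f' a
    by (simp_all add: C_def distrib_left right_diff_distrib sum.distrib sum_subtractf sum_distrib_left mult_ac)
  have C_sum: "C (\<lambda>j m. \<Sum>t\<in>UNIV. x t * f t j m) = (\<Sum>t\<in>UNIV. x t * C (f t))" for x :: "'n \<Rightarrow> real" and f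
  proof -
    have "C (\<lambda>j m. \<Sum>t\<in>UNIV. x t * f t j m) = (\<Sum>j\<in>UNIV. \<Sum>t\<in>UNIV. \<Sum>m\<in>UNIV. x t * (?v j m * f t j m))"
      unfolding C_def by (rule sum.cong[OF refl], subst sum.swap) (simp add: sum_distrib_left mult_ac)
    also have "\<dots> = (\<Sum>t\<in>UNIV. x t * C (f t))"
      by (subst sum.swap) (simp add: C_def sum_distrib_left)
    finally show ?thesis .
  qed
  \<comment> \<open>Contracting a metric factor only renames an index. This and \<open>C2\<close>
    treat the four terms on the right whose metric factor carries \<open>j\<close> or
    \<open>m\<close>; these then cancel among themselves.\<close>
  have C1: "C (\<lambda>j m. h j s * f m) = f s" for f s
  proof -
    have "C (\<lambda>j m. h j s * f m) = (\<Sum>m\<in>UNIV. (\<Sum>j\<in>UNIV. ?v m j * h j s) * f m)"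
      unfolding C_def by (subst sum.swap) (simp add: sum_distrib_left sum_distrib_right mult_ac inv_metric_sym[OF p, of _ m for m])
    then show ?thesis
      by (simp add: h_def inv_metric_mult(2)[OF p] if_distrib[of "\<lambda>x. x * _"] cong: if_cong)
  qed
  have C2: "C (\<lambda>j m. h m s * f j) = f s" for f s
  proof -
    have "C (\<lambda>j m. h m s * f j) = (\<Sum>j\<in>UNIV. (\<Sum>m\<in>UNIV. ?v j m * h m s) * f j)"
      unfolding C_def by (simp add: sum_distrib_left sum_distrib_right mult_ac)
    then show ?thesis
      by (simp add: h_def inv_metric_mult(2)[OF p] if_distrib[of "\<lambda>x. x * _"] cong: if_cong)
  qed
  have CR: "C (\<lambda>j m. R j k l m) = - ricci g c p [] [k, l]" for k l
    unfolding C_def R_def by (rule ricci_trace[OF p])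
  define S where "S t m = (\<Sum>j\<in>UNIV. ?v j m * ?M s i j t)" for t m
  have S: "S t m = - S m t" for t m
    unfolding S_def by (rule raised_riemann_skew[OF p])
  have "C (\<lambda>j m. \<Sum>t\<in>UNIV. ?M s i j t * R t k l m) = (\<Sum>m\<in>UNIV. \<Sum>j\<in>UNIV. \<Sum>t\<in>UNIV. ?v j m * ?M s i j t * R t k l m)"
    unfolding C_def by (subst sum.swap) (simp add: sum_distrib_left mult_ac)
  also have "\<dots> = (\<Sum>m\<in>UNIV. \<Sum>t\<in>UNIV. S t m * R t k l m)"
    unfolding S_def sum_distrib_right by (rule sum.cong[OF refl], rule sum.swap)
  also have "\<dots> = (\<Sum>t\<in>UNIV. \<Sum>m\<in>UNIV. S t m * R t k l m)"
    by (rule sum.swap)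
  finally have T1: "C (\<lambda>j m. \<Sum>t\<in>UNIV. ?M s i j t * R t k l m) = (\<Sum>t\<in>UNIV. \<Sum>m\<in>UNIV. S t m * R t k l m)" .
  have "C (\<lambda>j m. \<Sum>t\<in>UNIV. ?M s i m t * R j k l t) = (\<Sum>j\<in>UNIV. \<Sum>m\<in>UNIV. \<Sum>t\<in>UNIV. ?v m j * ?M s i m t * R j k l t)"
    unfolding C_def by (simp add: sum_distrib_left mult.assoc inv_metric_sym[OF p, of j for j])
  also have "\<dots> = (\<Sum>j\<in>UNIV. \<Sum>t\<in>UNIV. S t j * R j k l t)"
    unfolding S_def sum_distrib_right by (rule sum.cong[OF refl], rule sum.swap)
  \<comment> \<open>Up to bound names this is the negative of \<open>T1\<close>, by skewness of
    \<open>S\<close>.\<close>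
  finally have T4: "C (\<lambda>j m. \<Sum>t\<in>UNIV. ?M s i m t * R j k l t) = - (\<Sum>j\<in>UNIV. \<Sum>t\<in>UNIV. S j t * R j k l t)"
    by (subst (asm) S) (simp add: sum_negf)
  have "(\<Sum>t\<in>UNIV. ?M s i j t * R t k l m) + (\<Sum>t\<in>UNIV. ?M s i k t * R j t l m)
      + (\<Sum>t\<in>UNIV. ?M s i l t * R j k t m) + (\<Sum>t\<in>UNIV. ?M s i m t * R j k l t)
    = L * (h j s * R i k l m - h j i * R s k l m + h k s * R j i l m - h k i * R j s l m
      + h l s * R j k i m - h l i * R j k s m + h m s * R j k l i - h m i * R j k l s)" (is "?l j m = ?r j m") for j m
  proof -
    have "nabla g (nabla g (riemann g)) c p [] (s # i # [j, k, l, m])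
        - nabla g (nabla g (riemann g)) c p [] (i # s # [j, k, l, m]) =
      (\<Sum>b<4. \<Sum>t\<in>UNIV. ?M s i ([j, k, l, m] ! b) t * riemann g c p [] ([j, k, l, m][b := t]))"
      by (intro ricci_identity p smooth_riemann) auto
    then show ?thesis unfolding deszcz
      by (simp add: numeral_eq_Suc R_def h_def del: riemann.simps)
  qed
  then have "C ?l = C ?r" by presburger
  then show ?thesis
    unfolding C_add C_diff C_mult C_sum T1 T4 C1 C2 CR
    by (simp add: sum_negf h_def[symmetric] algebra_simps del: ricci.simps)
qed

text \<open>In the cyclic sum over \<open>s\<close>, \<open>i\<close>, \<open>k\<close> the
  right-hand sides cancel because the metric and Ricci tensors are symmetric, whatever
  \<open>L\<close> is. The first sums on the left cancel by the Bianchi identity, as their Ricci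
  factor stays fixed.\<close>

lemma deszcz_ricci_cyclic:
  assumes p: "p \<in> cdom c" and deszcz: "\<And>s i k.
    (\<Sum>t\<in>UNIV. riemann_mixed g c p s i k t * ricci g c p [] [t, l])
      + (\<Sum>t\<in>UNIV. riemann_mixed g c p s i l t * ricci g c p [] [k, t]) =
    L * (g c p [] [k, s] * ricci g c p [] [i, l] - g c p [] [k, i] * ricci g c p [] [s, l]
      + g c p [] [l, s] * ricci g c p [] [k, i] - g c p [] [l, i] * ricci g c p [] [k, s])"
  shows "(\<Sum>t\<in>UNIV. riemann_mixed g c p s i l t * ricci g c p [] [k, t])
    + (\<Sum>t\<in>UNIV. riemann_mixed g c p i k l t * ricci g c p [] [s, t])
    + (\<Sum>t\<in>UNIV. riemann_mixed g c p k s l t * ricci g c p [] [i, t]) = 0"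
proof -
  have "(\<Sum>t\<in>UNIV. (riemann_mixed g c p s i k t + riemann_mixed g c p i k s t + riemann_mixed g c p k s i t)
      * ricci g c p [] [t, l]) = 0"
    by (simp only: bianchi[OF p] mult_zero_left sum.neutral_const)
  then have "(\<Sum>t\<in>UNIV. riemann_mixed g c p s i k t * ricci g c p [] [t, l])
    + (\<Sum>t\<in>UNIV. riemann_mixed g c p i k s t * ricci g c p [] [t, l])
    + (\<Sum>t\<in>UNIV. riemann_mixed g c p k s i t * ricci g c p [] [t, l]) = 0"
    by (simp only: distrib_right sum.distrib)
  moreover note deszcz[of s i k] deszcz[of i k s] deszcz[of k s i]
    ricci_sym[OF p, of k i] ricci_sym[OF p, of s i] ricci_sym[OF p, of k s]
    metric_sym[OF p, of k i] metric_sym[OF p, of s i] metric_sym[OF p, of k s]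
  ultimately show ?thesis by (simp add: algebra_simps del: ricci.simps)
qed

end

section \<open>Weakly Z symmetric manifolds\<close>

lemma inverse_transpose:
  fixes W Z :: "'n::finite \<Rightarrow> 'n \<Rightarrow> real"
  assumes "\<And>h l. (\<Sum>k\<in>UNIV. W k h * Z k l) = (if h = l then 1 else 0)"
  shows "(\<Sum>l\<in>UNIV. Z i l * W j l) = (if i = j then 1 else 0)"
proof -
  have "(\<chi> h k. W k h) ** (\<chi> k l. Z k l) = mat 1"
    by (simp add: matrix_matrix_mult_def mat_def vec_eq_iff assms)
  then have "((\<chi> k l. Z k l) ** (\<chi> h k. W k h)) $ i $ j = mat 1 $ i $ j"
    by (simp only: matrix_left_right_inverse)
  then show ?thesis by (simp add: matrix_matrix_mult_def mat_def)
qed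

text \<open>Contracting with \<open>W k h\<close>, where \<open>l = h\<close> differs from
  \<open>j\<close>, leaves \<open>v j\<close> on one side and an off-diagonal entry of the identity
  on the other. Two distinct indices are needed for this.\<close>

lemma nonsingular_cancel_vector:
  fixes W Z :: "'n::finite \<Rightarrow> 'n \<Rightarrow> real"
  assumes "CARD('n) > 1"
    and W: "\<And>h l. (\<Sum>k\<in>UNIV. W k h * Z k l) = (if h = l then 1 else 0)"
    and eq: "\<And>k j l. v j * Z k l = v l * Z k j"
  shows "v j = 0"
proof -
  obtain h where h: "h \<noteq> j"
  proof (rule ccontr)
    assume "\<not> thesis"
    then have "UNIV = {j}" using that by auto
    then have "CARD('n) = card {j}" by (rule arg_cong)
    then show False using assms(1) by simp
  qed
  have "v j = v j * (\<Sum>k\<in>UNIV. W k h * Z k h)"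
    by (simp add: W)
  also have "\<dots> = (\<Sum>k\<in>UNIV. W k h * (v j * Z k h))"
    by (simp add: sum_distrib_left mult_ac)
  also have "\<dots> = v h * (\<Sum>k\<in>UNIV. W k h * Z k j)"
    unfolding eq[of j _ h] by (simp add: sum_distrib_left mult_ac)
  finally show ?thesis using h by (simp add: W)
qed

text \<open>Contracting with \<open>W j l\<close>, the first term yields \<open>n * w i k\<close>
  with \<open>n\<close> the dimension and each other term \<open>w k i\<close>, so by skewness
  \<open>(n - 2) * w i k = 0\<close>.\<close>

lemma nonsingular_cancel_cyclic:
  fixes W Z w :: "'n::finite \<Rightarrow> 'n \<Rightarrow> real"
  assumes card: "CARD('n) > 2"
    and W: "\<And>h l. (\<Sum>k\<in>UNIV. W k h * Z k l) = (if h = l then 1 else 0)"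
    and skew: "\<And>i k. w i k = - w k i"
    and eq: "\<And>i k j l. w i k * Z j l + w k j * Z i l + w j i * Z k l = 0"
  shows "w i k = 0"
proof -
  have WT: "(\<Sum>l\<in>UNIV. Z i l * W j l) = (if i = j then 1 else 0)" for i j
    by (rule inverse_transpose) (rule W)
  have "0 = (\<Sum>j\<in>UNIV. \<Sum>l\<in>UNIV. (w i k * Z j l + w k j * Z i l + w j i * Z k l) * W j l)"
    by (simp only: eq mult_zero_left sum.neutral_const)
  also have "\<dots> = (\<Sum>j\<in>UNIV. w i k * (\<Sum>l\<in>UNIV. Z j l * W j l) + w k j * (\<Sum>l\<in>UNIV. Z i l * W j l)
      + w j i * (\<Sum>l\<in>UNIV. Z k l * W j l))"
    by (simp add: sum.distrib sum_distrib_left distrib_right mult.assoc)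
  also have "\<dots> = real CARD('n) * w i k + w k i + w k i"
    by (simp add: WT sum.distrib if_distrib[of "\<lambda>x. _ * x"] cong: if_cong)
  finally have "(real CARD('n) - 2) * w i k = 0"
    using skew[of k i] by (simp add: algebra_simps)
  then show ?thesis using card by simp
qed

section \<open>Covariant derivatives of the Z tensor\<close>

context riemannian_chart
begin

lemma nabla_diff:
  assumes "tensor_field \<A> 0 1 A" "tensor_field \<A> 0 1 B" "p \<in> cdom c"
  shows "nabla g (\<lambda>c p up lo. A c p up lo - B c p up lo) c p [] [i, j] =
    nabla g A c p [] [i, j] - nabla g B c p [] [i, j]"
  using chart_partial_diff[OF assms(3) tensor_field_smooth_in[OF assms(1)] tensor_field_smooth_in[OF assms(2)]]
  by (simp add: right_diff_distrib sum_subtractf)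

lemma smooth_Z:
  assumes "smooth_in c \<phi>" "length lo = 2"
  shows "smooth_in c (\<lambda>q. Z_tensor g \<phi> c q [] lo)"
proof -
  obtain k l where "lo = [k, l]"
    using assms by (auto simp: numeral_eq_Suc length_Suc_conv)
  then show ?thesis
    unfolding Z_tensor_def using smooth_ricci[of lo] assms
    by (auto intro!: smooth_in_add smooth_in_mult smooth_metric simp del: ricci.simps)
qed

lemma Z_sym:
  assumes "p \<in> cdom c"
  shows "Z_tensor g \<phi> c p [] [i, j] = Z_tensor g \<phi> c p [] [j, i]"
  unfolding Z_tensor_def ricci_sym[OF assms, of i j] metric_sym[OF assms, of i j] ..

lemma nabla_sym:
  assumes sym: "\<And>q i j. q \<in> cdom c \<Longrightarrow> T c q [] [i, j] = T c q [] [j, i]" and p: "p \<in> cdom c"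
  shows "nabla g T c p [] [k, i, j] = nabla g T c p [] [k, j, i]"
proof -
  have "chart_partial c k (\<lambda>q. T c q [] [i, j]) p = chart_partial c k (\<lambda>q. T c q [] [j, i]) p"
    by (rule chart_partial_cong[OF is_chart p]) (rule sym)
  moreover have "T c p [] [s, j] = T c p [] [j, s]" "T c p [] [i, s] = T c p [] [s, i]" for s
    using sym[OF p] by blast+
  ultimately show ?thesis by (simp add: algebra_simps)
qed

text \<open>The Ricci identity gives two sums per commutator. The cyclic sum of the first kind
  vanishes by Bianchi. In the second kind the Ricci part of \<open>Z\<close> is covered by the
  hypothesis, and the metric part is moved back to the Bianchi identity by skewness.\<close>

lemma Z_commutator_cyclic:
  assumes p: "p \<in> cdom c" and \<phi>: "smooth_in c \<phi>"
    and deszcz: "\<And>s i k l.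
      (\<Sum>t\<in>UNIV. riemann_mixed g c p s i l t * ricci g c p [] [k, t])
    + (\<Sum>t\<in>UNIV. riemann_mixed g c p i k l t * ricci g c p [] [s, t])
    + (\<Sum>t\<in>UNIV. riemann_mixed g c p k s l t * ricci g c p [] [i, t]) = 0"
  defines "N \<equiv> nabla g (nabla g (Z_tensor g \<phi>)) c p []"
  shows "(N [i, k, j, l] - N [k, i, j, l]) + (N [k, j, i, l] - N [j, k, i, l])
    + (N [j, i, k, l] - N [i, j, k, l]) = 0"
proof -
  let ?M = "riemann_mixed g c p" and ?Z = "\<lambda>i j. Z_tensor g \<phi> c p [] [i, j]"
  have comm: "N [i, k, j, l] - N [k, i, j, l] =
      (\<Sum>t\<in>UNIV. ?M i k j t * ?Z t l) + (\<Sum>t\<in>UNIV. ?M i k l t * ?Z j t)" for i k j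
  proof -
    have "N (i # k # [j, l]) - N (k # i # [j, l]) =
      (\<Sum>b<2. \<Sum>t\<in>UNIV. ?M i k ([j, l] ! b) t * Z_tensor g \<phi> c p [] ([j, l][b := t]))"
      unfolding N_def by (intro ricci_identity p smooth_Z \<phi>) auto
    then show ?thesis by (simp add: numeral_2_eq_2)
  qed
  have "(\<Sum>t\<in>UNIV. (?M i k j t + ?M k j i t + ?M j i k t) * ?Z t l) = 0"
    by (simp only: bianchi[OF p] mult_zero_left sum.neutral_const)
  then have first: "(\<Sum>t\<in>UNIV. ?M i k j t * ?Z t l) + (\<Sum>t\<in>UNIV. ?M k j i t * ?Z t l)
      + (\<Sum>t\<in>UNIV. ?M j i k t * ?Z t l) = 0"
    by (simp only: distrib_right sum.distrib)
  have lower: "(\<Sum>t\<in>UNIV. ?M i k l t * g c p [] [j, t]) = - (\<Sum>t\<in>UNIV. ?M i k j t * g c p [] [t, l])" for i k j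
    using riemann_skew[OF p, of i k l j] by (simp add: metric_sym[OF p, of j])
  have "(\<Sum>t\<in>UNIV. (?M i k j t + ?M k j i t + ?M j i k t) * g c p [] [t, l]) = 0"
    by (simp only: bianchi[OF p] mult_zero_left sum.neutral_const)
  then have "(\<Sum>t\<in>UNIV. ?M i k l t * g c p [] [j, t]) + (\<Sum>t\<in>UNIV. ?M k j l t * g c p [] [i, t])
      + (\<Sum>t\<in>UNIV. ?M j i l t * g c p [] [k, t]) = 0"
    unfolding lower by (simp only: distrib_right sum.distrib)
  \<comment> \<open>The factor is distributed so that each product is an atom for the linear
    arithmetic that follows.\<close>
  then have "\<phi> p * (\<Sum>t\<in>UNIV. ?M i k l t * g c p [] [j, t]) + \<phi> p * (\<Sum>t\<in>UNIV. ?M k j l t * g c p [] [i, t])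
      + \<phi> p * (\<Sum>t\<in>UNIV. ?M j i l t * g c p [] [k, t]) = 0"
    by (simp only: distrib_left[symmetric] mult_zero_right)
  moreover have Z: "(\<Sum>t\<in>UNIV. ?M i k l t * ?Z j t) = (\<Sum>t\<in>UNIV. ?M i k l t * ricci g c p [] [j, t])
      + \<phi> p * (\<Sum>t\<in>UNIV. ?M i k l t * g c p [] [j, t])" for i k j
    by (simp add: Z_tensor_def distrib_left sum.distrib sum_distrib_left mult_ac del: ricci.simps)
  ultimately have "(\<Sum>t\<in>UNIV. ?M i k l t * ?Z j t) + (\<Sum>t\<in>UNIV. ?M k j l t * ?Z i t)
      + (\<Sum>t\<in>UNIV. ?M j i l t * ?Z k t) = 0"
    using deszcz[of i k l j] unfolding Z by linarith
  with first show ?thesis unfolding comm by linarith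
qed

text \<open>This is the Leibniz rule for the recurrence with \<open>D\<close> already replaced by
  \<open>B\<close>. The recurrence must hold on the whole chart because it is
  differentiated.\<close>

lemma nabla_recurrence:
  assumes A: "smooth_in c (\<lambda>q. A c q [] [k])" and B: "\<And>j. smooth_in c (\<lambda>q. B c q [] [j])"
    and Z: "\<And>i j. smooth_in c (\<lambda>q. Z c q [] [i, j])"
    and p: "p \<in> cdom c"
    and rec: "\<And>q k j l. q \<in> cdom c \<Longrightarrow> nabla g Z c q [] [k, j, l] = A c q [] [k] * Z c q [] [j, l]
      + B c q [] [j] * Z c q [] [k, l] + B c q [] [l] * Z c q [] [k, j]"
  shows "nabla g (nabla g Z) c p [] [i, k, j, l] =
      nabla g A c p [] [i, k] * Z c p [] [j, l] + A c p [] [k] * nabla g Z c p [] [i, j, l]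
    + nabla g B c p [] [i, j] * Z c p [] [k, l] + B c p [] [j] * nabla g Z c p [] [i, k, l]
    + nabla g B c p [] [i, l] * Z c p [] [k, j] + B c p [] [l] * nabla g Z c p [] [i, k, j]"
proof -
  let ?G = "christoffel g c p"
  let ?A = "\<lambda>k. A c p [] [k]" and ?B = "\<lambda>k. B c p [] [k]" and ?Z = "\<lambda>i j. Z c p [] [i, j]"
  have "chart_partial c i (\<lambda>q. nabla g Z c q [] [k, j, l]) p =
    chart_partial c i (\<lambda>q. A c q [] [k] * Z c q [] [j, l]
      + B c q [] [j] * Z c q [] [k, l] + B c q [] [l] * Z c q [] [k, j]) p"
    by (rule chart_partial_cong[OF is_chart p]) (rule rec)
  also have "\<dots> = A c p [] [k] * chart_partial c i (\<lambda>q. Z c q [] [j, l]) p + chart_partial c i (\<lambda>q. A c q [] [k]) p * Z c p [] [j, l]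
     + (B c p [] [j] * chart_partial c i (\<lambda>q. Z c q [] [k, l]) p + chart_partial c i (\<lambda>q. B c q [] [j]) p * Z c p [] [k, l])
     + (B c p [] [l] * chart_partial c i (\<lambda>q. Z c q [] [k, j]) p + chart_partial c i (\<lambda>q. B c q [] [l]) p * Z c p [] [k, j])"
    using A B Z by (simp add: chart_partial_add[OF p] chart_partial_mult[OF p] smooth_in_add smooth_in_mult)
  finally have D: "chart_partial c i (\<lambda>q. nabla g Z c q [] [k, j, l]) p = \<dots>" .
  have "nabla g (nabla g Z) c p [] [i, k, j, l] = chart_partial c i (\<lambda>q. nabla g Z c q [] [k, j, l]) p
    - (\<Sum>s\<in>UNIV. ?G s i k * nabla g Z c p [] [s, j, l]) - (\<Sum>s\<in>UNIV. ?G s i j * nabla g Z c p [] [k, s, l])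
    - (\<Sum>s\<in>UNIV. ?G s i l * nabla g Z c p [] [k, j, s])"
    by (subst nabla.simps(2)) (simp add: numeral_eq_Suc algebra_simps del: nabla.simps)
  then have eq: "nabla g (nabla g Z) c p [] [i, k, j, l] = chart_partial c i (\<lambda>q. nabla g Z c q [] [k, j, l]) p
    - (\<Sum>s\<in>UNIV. ?G s i k * (?A s * ?Z j l + ?B j * ?Z s l + ?B l * ?Z s j))
    - (\<Sum>s\<in>UNIV. ?G s i j * (?A k * ?Z s l + ?B s * ?Z k l + ?B l * ?Z k s))
    - (\<Sum>s\<in>UNIV. ?G s i l * (?A k * ?Z j s + ?B j * ?Z k s + ?B s * ?Z k j))"
    unfolding rec[OF p] .
  have n1: "nabla g T c p [] [i, a] = chart_partial c i (\<lambda>q. T c q [] [a]) p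
      - (\<Sum>s\<in>UNIV. ?G s i a * T c p [] [s])" for T :: "('a, 'n) tensor" and a
    by simp
  have n2: "nabla g T c p [] [i, a, b] = chart_partial c i (\<lambda>q. T c q [] [a, b]) p
      - (\<Sum>s\<in>UNIV. ?G s i a * T c p [] [s, b]) - (\<Sum>s\<in>UNIV. ?G s i b * T c p [] [a, s])"
    for T :: "('a, 'n) tensor" and a b
    by simp
  \<comment> \<open>The three forms differ in the place of the covector that carries the summed
    index, one for each lower index of \<open>nabla g Z\<close>.\<close>
  have factor: "(\<Sum>s\<in>UNIV. f s * (x s * u + v * y s + w * z s)) =
      (\<Sum>s\<in>UNIV. f s * x s) * u + v * (\<Sum>s\<in>UNIV. f s * y s) + w * (\<Sum>s\<in>UNIV. f s * z s)"
    "(\<Sum>s\<in>UNIV. f s * (v * y s + x s * u + w * z s)) =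
      (\<Sum>s\<in>UNIV. f s * x s) * u + v * (\<Sum>s\<in>UNIV. f s * y s) + w * (\<Sum>s\<in>UNIV. f s * z s)"
    "(\<Sum>s\<in>UNIV. f s * (v * y s + w * z s + x s * u)) =
      (\<Sum>s\<in>UNIV. f s * x s) * u + v * (\<Sum>s\<in>UNIV. f s * y s) + w * (\<Sum>s\<in>UNIV. f s * z s)"
    for f x y z :: "'n \<Rightarrow> real" and u v w
    by (simp_all add: distrib_left sum.distrib sum_distrib_left sum_distrib_right mult_ac)
  show ?thesis
    unfolding eq factor D n1 n2 by algebra
qed

end

theorem proposition4p15:
  fixes X :: "'a topology"
    and \<A> :: "('a, 'n::finite) chart set"
    and g A B D :: "('a, 'n) tensor"
    and \<phi> :: "'a \<Rightarrow> real"
  assumes "CARD('n) > 3"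
    and "riemannian_manifold X \<A> g"
    and "weakly_Z_symmetric \<A> g \<phi> A B D"
    and "deszcz_pseudosymmetric X \<A> g"
    and "nonsingular \<A> (Z_tensor g \<phi>)"
  shows "closed_one_form \<A> g (\<lambda>c p up lo. A c p up lo - B c p up lo)"
proof -
  have fields: "smooth_scalar \<A> \<phi>" "tensor_field \<A> 0 1 A" "tensor_field \<A> 0 1 B"
    using assms(3) by (auto simp: weakly_Z_symmetric_def)
  have "nabla g (\<lambda>c p up lo. A c p up lo - B c p up lo) c p [] [i, k] =
      nabla g (\<lambda>c p up lo. A c p up lo - B c p up lo) c p [] [k, i]" if c: "c \<in> \<A>" and p: "p \<in> cdom c" for c p i k
  proof -
    interpret riemannian_chart X \<A> g c
      by unfold_locales (use assms(2) c in auto)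
    let ?Z = "\<lambda>q i j. Z_tensor g \<phi> c q [] [i, j]"
    have \<phi>: "smooth_in c \<phi>"
      using fields(1) c by (simp add: smooth_scalar_def smooth_in_def)
    obtain W where "\<forall>c\<in>\<A>. \<forall>q\<in>cdom c. \<forall>h l.
        (\<Sum>k\<in>UNIV. W c q [k, h] [] * Z_tensor g \<phi> c q [] [k, l]) = (if h = l then 1 else 0)"
      using assms(5) unfolding nonsingular_def by (elim exE conjE) (rule that)
    note W = this[rule_format, OF c]
    have recD: "nabla g (Z_tensor g \<phi>) c q [] [k, j, l] = A c q [] [k] * ?Z q j l
        + B c q [] [j] * ?Z q k l + D c q [] [l] * ?Z q k j" if "q \<in> cdom c" for q k j l
      using assms(3) c that unfolding weakly_Z_symmetric_def by blast
    \<comment> \<open>The derivative of \<open>Z\<close> is symmetric in its last two indices;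
      comparing the recurrence before and after exchanging them gives the relation needed for
      cancellation. It is proved at every \<open>q\<close> of the chart for the later
      differentiation.\<close>
    have "B c q [] [j] - D c q [] [j] = 0" if q: "q \<in> cdom c" for q j
    proof (rule nonsingular_cancel_vector[where W = "\<lambda>k h. W c q [k, h] []" and Z = "?Z q"])
      show "(B c q [] [j] - D c q [] [j]) * ?Z q k l = (B c q [] [l] - D c q [] [l]) * ?Z q k j" for k j l
        using nabla_sym[of "Z_tensor g \<phi>", OF Z_sym q, of k j l] Z_sym[OF q, of \<phi> j l]
        by (simp add: recD[OF q] algebra_simps del: nabla.simps)
    qed (use assms(1) W[OF q] in auto)
    then have rec: "nabla g (Z_tensor g \<phi>) c q [] [k, j, l] = A c q [] [k] * ?Z q j l
        + B c q [] [j] * ?Z q k l + B c q [] [l] * ?Z q k j" if "q \<in> cdom c" for q k j l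
      using recD[OF that] that by simp
    define a where "a i k = nabla g A c p [] [i, k]" for i k
    define b where "b i k = nabla g B c p [] [i, k]" for i k
    have NN: "nabla g (nabla g (Z_tensor g \<phi>)) c p [] [i, k, j, l] =
      a i k * ?Z p j l + A c p [] [k] * nabla g (Z_tensor g \<phi>) c p [] [i, j, l]
    + b i j * ?Z p k l + B c p [] [j] * nabla g (Z_tensor g \<phi>) c p [] [i, k, l]
    + b i l * ?Z p k j + B c p [] [l] * nabla g (Z_tensor g \<phi>) c p [] [i, k, j]" for i k j l
      unfolding a_def b_def
      by (intro nabla_recurrence p rec smooth_Z \<phi> tensor_field_smooth_in[OF fields(2)]
          tensor_field_smooth_in[OF fields(3)]) simp_all
    \<comment> \<open>Here \<open>L\<close> is a number, the value at \<open>p\<close> of the scalar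
      function.\<close>
    obtain L where L: "nabla g (nabla g (riemann g)) c p [] [s, i, j, k, l, m]
           - nabla g (nabla g (riemann g)) c p [] [i, s, j, k, l, m] =
           L *
             (g c p [] [j, s] * riemann g c p [] [i, k, l, m]
              - g c p [] [j, i] * riemann g c p [] [s, k, l, m]
              + g c p [] [k, s] * riemann g c p [] [j, i, l, m]
              - g c p [] [k, i] * riemann g c p [] [j, s, l, m]
              + g c p [] [l, s] * riemann g c p [] [j, k, i, m]
              - g c p [] [l, i] * riemann g c p [] [j, k, s, m]
              + g c p [] [m, s] * riemann g c p [] [j, k, l, i]
              - g c p [] [m, i] * riemann g c p [] [j, k, l, s])" for s i j k l m
      using assms(4) c p unfolding deszcz_pseudosymmetric_def by blast
    note cyc = Z_commutator_cyclic[OF p \<phi> deszcz_ricci_cyclic[OF p deszcz_ricci[OF p L]], unfolded NN rec[OF p]]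
    \<comment> \<open>With first derivatives of \<open>Z\<close> replaced by the recurrence, the
      terms quadratic in \<open>A\<close> and \<open>B\<close> cancel cyclically, as do those with
      \<open>b\<close> carrying the index \<open>l\<close>. The remaining \<open>b\<close> terms
      regroup with a minus sign next to the \<open>a\<close> terms.\<close>
    have "((a i k - b i k) - (a k i - b k i)) * ?Z p j l + ((a k j - b k j) - (a j k - b j k)) * ?Z p i l
      + ((a j i - b j i) - (a i j - b i j)) * ?Z p k l = 0" for i k j l
      using cyc[of i k j l] unfolding Z_sym[OF p, of \<phi> k i] Z_sym[OF p, of \<phi> j i] Z_sym[OF p, of \<phi> k j]
      by (simp add: algebra_simps)
    then have "(a i k - b i k) - (a k i - b k i) = 0"
      by (intro nonsingular_cancel_cyclic[where w = "\<lambda>i k. (a i k - b i k) - (a k i - b k i)"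
            and W = "\<lambda>k h. W c p [k, h] []" and Z = "?Z p"])
        (use assms(1) W[OF p] in auto)
    then show ?thesis
      by (simp only: nabla_diff[OF fields(2,3) p] a_def b_def)
  qed
  moreover have "tensor_field \<A> 0 1 (\<lambda>c p up lo. A c p up lo - B c p up lo)"
    unfolding tensor_field_def
  proof (intro conjI ballI allI impI)
    fix c and up lo :: "'n list" assume c: "c \<in> \<A>" and len: "length up = 0" "length lo = 1"
    interpret riemannian_chart X \<A> g c
      by unfold_locales (use assms(2) c in auto)
    show "smooth_on (coord c ` cdom c) (\<lambda>x. A c (param c x) up lo - B c (param c x) up lo)"
      using smooth_in_diff[OF tensor_field_smooth_in[OF fields(2) len] tensor_field_smooth_in[OF fields(3) len]]
      by (simp add: smooth_in_def)
  next
    fix c d p and up lo :: "'n list"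
    assume "c \<in> \<A>" "d \<in> \<A>" "p \<in> cdom c \<inter> cdom d" "length up = 0" "length lo = 1"
    \<comment> \<open>The transformation law is stated for a generic \<open>T\<close> and used for
      both \<open>A\<close> and \<open>B\<close>; it is linear in the components, so the difference
      obeys it too.\<close>
    then have "T d p up lo = (\<Sum>up'\<in>{xs. length xs = 0}. \<Sum>lo'\<in>{xs. length xs = 1}.
        (\<Prod>i<0. jacobian c d p (up ! i) (up' ! i)) * (\<Prod>j<1. jacobian d c p (lo' ! j) (lo ! j)) * T c p up' lo')"
      if "tensor_field \<A> 0 1 T" for T
      using that unfolding tensor_field_def by blast
    from this[OF fields(2)] this[OF fields(3)]
    show "A d p up lo - B d p up lo = (\<Sum>up'\<in>{xs. length xs = 0}. \<Sum>lo'\<in>{xs. length xs = 1}.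
        (\<Prod>i<0. jacobian c d p (up ! i) (up' ! i)) * (\<Prod>j<1. jacobian d c p (lo' ! j) (lo ! j)) *
        (A c p up' lo' - B c p up' lo'))"
      by (simp only: right_diff_distrib sum_subtractf)
  qed
  ultimately show ?thesis
    by (simp add: closed_one_form_def del: nabla.simps)
qed

end
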